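(* Assume that $\mathbb{K}$ is a real closed field. Then every matrix $A\in M_n(\overline{\mathbb{K}})\setminus\{0\}$ has a singular value decomposition (SVD) $A=\sum_{i=1}^p\sigma_iA_i$. If $A\in M_n(\mathbb{K})\setminus\{0\}$, then we can take every $A_i$ in $M_n(\mathbb{K})$.
   Context: For $\mathbb{K}$ real closed, $\overline{\mathbb{K}}=\mathbb{K}(\sqrt{-1})$ is its algebraic closure, $\mathbb{K}$ has its unique field ordering, and for $A\in M_n(\overline{\mathbb{K}})$, $A^*$ is the transpose conjugate of $A$ (conjugation $a+b\sqrt{-1}\mapsto a-b\sqrt{-1}$, $a,b\in\mathbb{K}$). A non-empty family of matrices $A_1,\dots,A_p\in M_n(\overline{\mathbb{K}})\setminus\{0\}$ is an SVD system if $A_i^*A_j=A_iA_j^*=0$ for every $i\ne j$ and $A_iA_i^*A_i=A_i$ for every $i$. A singular value decomposition (SVD) of $A\in M_n(\overline{\mathbb{K}})$ is any decomposition $A=\sum_{i=1}^p\sigma_iA_i$ where $A_1,\dots,A_p\in M_n(\overline{\mathbb{K}})\setminus\{0\}$ form an SVD system and $\sigma_1>\cdots>\sigma_p>0$ are elements of $\mathbb{K}$. *)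

theory Defs
  imports "Jordan_Normal_Form.Schur_Decomposition"
begin

section \<open>Real closed fields\<close>

text \<open>The ordering is not extra data: in such a field the nonnegative elements are exactly the squares.\<close>

class real_closed_field = linordered_field +
  assumes nonneg_is_square: "0 \<le> x \<Longrightarrow> \<exists>y. y * y = x"
    and odd_degree_has_root_aux: "odd n \<Longrightarrow> f n \<noteq> 0 \<Longrightarrow> \<exists>x. (\<Sum>k\<le>n. f k * x ^ k) = 0"

text \<open>As for \<^class>\<open>alg_closed_field\<close>, the type \<open>'a poly\<close> is not available inside the class
  specification; the following is the intended form of the second axiom.\<close>

lemma odd_degree_has_root:
  fixes p :: "'a::real_closed_field poly"
  assumes "odd (degree p)"
  shows "\<exists>x. poly p x = 0"
  using odd_degree_has_root_aux [of "degree p" "coeff p"] assms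
  by (cases "p = 0") (auto simp: poly_altdef)

instance real :: real_closed_field
proof
  show "\<exists>y. y * y = x" if "0 \<le> x" for x :: real
    using that by (intro exI [of _ "sqrt x"]) simp
  have pos: "\<exists>x. poly p x = 0" if odd: "odd (degree p)" and lc: "0 < lead_coeff p" for p :: "real poly"
  proof -
    obtain u where u: "\<And>x. x \<ge> u \<Longrightarrow> poly p x \<ge> lead_coeff p"
      using poly_pinfty_ge [OF lc] odd by force
    let ?q = "- pcompose p [:0, -1:]"
    have "degree ?q \<noteq> 0"
      using odd by (auto simp: degree_pcompose elim: oddE)
    have "lead_coeff (pcompose p [:0, -1:]) = - lead_coeff p"
      using odd by (subst lead_coeff_comp) auto
    then have "0 < lead_coeff ?q"
      using lc by simp
    then obtain v where v: "\<And>x. x \<ge> v \<Longrightarrow> poly ?q x \<ge> lead_coeff ?q"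
      using poly_pinfty_ge [of ?q "lead_coeff ?q"] \<open>degree ?q \<noteq> 0\<close> by blast
    define w where "w = Max {u, v, 1}"
    have "poly p w > 0"
      using u [of w] lc by (simp add: w_def)
    moreover have "poly p (- w) < 0"
    proof -
      have "lead_coeff ?q \<le> poly ?q w"
        by (rule v) (simp add: w_def)
      with \<open>0 < lead_coeff ?q\<close> have "0 < poly ?q w"
        by linarith
      then show ?thesis
        by (simp add: poly_pcompose)
    qed
    moreover have "- w < w"
      by (simp add: w_def)
    ultimately show ?thesis
      using poly_IVT_pos [of "- w" w p] by blast
  qed
  show "\<exists>x. (\<Sum>k\<le>n. f k * x ^ k) = 0" if n: "odd n" "f n \<noteq> 0" for n and f :: "nat \<Rightarrow> real"
  proof -
    define p where "p = (\<Sum>k\<le>n. monom (f k) k)"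
    have coeff_p: "coeff p k = (if k \<le> n then f k else 0)" for k
      by (auto simp: p_def coeff_sum if_distrib cong: if_cong)
    have deg: "degree p = n"
      using n by (intro antisym degree_le le_degree) (auto simp: coeff_p)
    have "\<exists>x. poly p x = 0"
    proof (cases "0 < f n")
      case True
      then show ?thesis
        using pos [of p] n by (simp add: deg coeff_p)
    next
      case False
      then have "\<exists>x. poly (- p) x = 0"
        using pos [of "- p"] n by (simp add: deg coeff_p)
      then show ?thesis
        by simp
    qed
    then show ?thesis
      by (simp add: p_def poly_sum poly_monom)
  qed
qed


section \<open>The extension by a square root of -1\<close>

text \<open>\<open>GExt a b\<close> stands for $a + b\sqrt{-1}$. Over an ordered field -1 is not a square, so this is a
  field.\<close>

datatype 'a gext = GExt (re_part: 'a) (im_part: 'a)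

lemma gext_eq_iff: "x = y \<longleftrightarrow> re_part x = re_part y \<and> im_part x = im_part y"
  by (auto intro: gext.expand)

instantiation gext :: (linordered_field) field
begin

definition "0 = GExt 0 0"
definition "1 = GExt 1 0"
definition "x + y = GExt (re_part x + re_part y) (im_part x + im_part y)"
definition "x - y = GExt (re_part x - re_part y) (im_part x - im_part y)"
definition "- x = GExt (- re_part x) (- im_part x)"
definition "x * y = GExt (re_part x * re_part y - im_part x * im_part y)
                         (re_part x * im_part y + im_part x * re_part y)"
definition "inverse x =
  (let d = re_part x * re_part x + im_part x * im_part x in GExt (re_part x / d) (- im_part x / d))"
definition "x div y = x * inverse y" for x y :: "'a gext"

lemmas gext_defs = zero_gext_def one_gext_def plus_gext_def minus_gext_def uminus_gext_def
  times_gext_def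

instance
proof
  fix x y z :: "'a gext"
  show "x * y * z = x * (y * z)" "x * y = y * x" "1 * x = x" "(x + y) * z = x * z + y * z"
    "x + y + z = x + (y + z)" "x + y = y + x" "0 + x = x" "- x + x = 0" "x - y = x + - y"
    "(0 :: 'a gext) \<noteq> 1"
    by (simp_all add: gext_defs algebra_simps)
  show "x div y = x * inverse y" by (fact divide_gext_def)
  show "inverse 0 = (0 :: 'a gext)" by (simp add: gext_defs inverse_gext_def)
  show "inverse x * x = 1" if "x \<noteq> 0"
  proof -
    have "re_part x * re_part x + im_part x * im_part x \<noteq> 0"
      using that by (auto simp: sum_squares_eq_zero_iff gext_eq_iff zero_gext_def)
    then show ?thesis
      by (simp add: inverse_gext_def Let_def gext_defs diff_divide_distrib [symmetric]
          add_divide_distrib [symmetric] algebra_simps)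
  qed
qed

end

instantiation gext :: (linordered_field) conjugatable_field
begin

definition "conjugate x = GExt (re_part x) (- im_part x)"

instance
  by standard (auto simp: conjugate_gext_def gext_defs gext_eq_iff algebra_simps)

end

definition of_base :: "'a::zero \<Rightarrow> 'a gext" where
  "of_base a = GExt a 0"

lemma of_base_simps:
  "of_base (0 :: 'a::linordered_field) = 0"
  "of_base (1 :: 'a) = 1"
  "of_base (a + b :: 'a) = of_base a + of_base b"
  "of_base (a * b :: 'a) = of_base a * of_base b"
  by (simp_all add: of_base_def gext_defs)

lemma GExt_0_1_square: "GExt 0 1 * GExt 0 1 = (- 1 :: 'a::linordered_field gext)"
  by (simp add: gext_defs)

lemma GExt_decompose:
  "GExt a b = of_base a + of_base b * GExt 0 (1 :: 'a::linordered_field)"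
  by (simp add: of_base_def gext_defs)

definition base_mats :: "nat \<Rightarrow> 'a::linordered_field gext mat set" where
  "base_mats n = map_mat of_base ` carrier_mat n n"


lemma mat_adjoint_index:
  fixes A :: "'a::linordered_field gext mat"
  assumes "i < dim_col A" "j < dim_row A"
  shows "mat_adjoint A $$ (i, j) = conjugate (A $$ (j, i))"
  using assms by (simp add: mat_adjoint_def mat_of_rows_index)


section \<open>Singular value decompositions\<close>

definition SVD_system :: "nat \<Rightarrow> nat \<Rightarrow> (nat \<Rightarrow> 'a::linordered_field gext mat) \<Rightarrow> bool" where
  "SVD_system n p B \<longleftrightarrow>
     1 \<le> p \<and>
     (\<forall>i\<in>{1..p}. B i \<in> carrier_mat n n \<and> B i \<noteq> 0\<^sub>m n n) \<and>
     (\<forall>i\<in>{1..p}. \<forall>j\<in>{1..p}. i \<noteq> j \<longrightarrow>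
        mat_adjoint (B i) * B j = 0\<^sub>m n n \<and> B i * mat_adjoint (B j) = 0\<^sub>m n n) \<and>
     (\<forall>i\<in>{1..p}. B i * mat_adjoint (B i) * B i = B i)"

definition SVD :: "nat \<Rightarrow> 'a::linordered_field gext mat \<Rightarrow> nat \<Rightarrow> (nat \<Rightarrow> 'a) \<Rightarrow>
    (nat \<Rightarrow> 'a gext mat) \<Rightarrow> bool" where
  "SVD n A p \<sigma> B \<longleftrightarrow>
     SVD_system n p B \<and>
     strict_antimono_on {1..p} \<sigma> \<and>
     (\<forall>i\<in>{1..p}. 0 < \<sigma> i) \<and>
     A = (\<Oplus>\<^bsub>ring_mat TYPE('a gext) n ()\<^esub> i\<in>{1..p}. of_base (\<sigma> i) \<cdot>\<^sub>m B i)"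

end

theory Submission
  imports Defs "HOL-Algebra.Algebraic_Closure_Type"
begin

text \<open>
  The decomposition is read off from the Hermitian matrix \<open>H = A\<^sup>*A\<close>. Suppose \<open>H\<close> is annihilated by a
  product of distinct factors \<open>x - \<lambda>\<close> with \<open>\<lambda>\<close> in the base field. Then the Lagrange polynomials of
  these \<open>\<lambda>\<close>, evaluated at \<open>H\<close>, are Hermitian projections \<open>P\<^sub>\<lambda>\<close> that are mutually orthogonal, sum to
  the identity and satisfy \<open>H P\<^sub>\<lambda> = \<lambda> P\<^sub>\<lambda>\<close> (\<open>hermitian_spectral_projections\<close>). Since
  \<open>(A P\<^sub>\<lambda>)\<^sup>*(A P\<^sub>\<lambda>) = \<lambda> P\<^sub>\<lambda>\<close>, every \<open>\<lambda>\<close> with \<open>A P\<^sub>\<lambda> \<noteq> 0\<close> is positive; with \<open>\<sigma>\<close> its positive square root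
  and \<open>B\<^sub>\<sigma> = \<sigma>\<^sup>-\<^sup>1 A P\<^sub>\<lambda>\<close>, the sum of the \<open>\<sigma> B\<^sub>\<sigma>\<close> is the sum of the \<open>A P\<^sub>\<lambda>\<close>, which is \<open>A\<close>, and the
  relations of an SVD system follow from those of the projections. The coefficients of the Lagrange
  polynomials lie in the base field, so for real \<open>A\<close> each \<open>B\<^sub>\<sigma>\<close> is real without further work.

  It remains to see that \<open>H\<close> is annihilated in this way. As a real matrix of twice the size, \<open>H\<close> is
  symmetric, and Householder reflections split off one eigenvector after another, so everything rests
  on \<open>symmetric_eigenvector\<close>: a symmetric matrix of positive size over a real closed field has an
  eigenvector over that field. This is where real closedness enters, and the argument is Laplace's
  proof of the fundamental theorem of algebra, carried out with symmetric matrices. One inducts on the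
  exponent of 2 in the size \<open>n\<close>. If \<open>n\<close> is odd, the characteristic polynomial has odd degree and hence
  a root. If \<open>n\<close> is even, \<open>n (n - 1) / 2\<close> contains one factor 2 less, and this is the size of the
  matrix of 2 by 2 minors of \<open>T + t\<close>, which is again symmetric (\<open>second_compound_eigenvector\<close>). Its
  eigenvalue in the base field has the form \<open>(t + d)(t + d')\<close> with \<open>d\<close> and \<open>d'\<close> eigenvalues of \<open>T\<close> in
  the algebraic closure (\<open>eigenvalue_pair_of_congruence\<close>). There are infinitely many \<open>t\<close> and finitely
  many pairs, so some pair serves two values of \<open>t\<close>; then \<open>d + d'\<close> and \<open>d d'\<close> lie in the base field,
  and \<open>d\<close> is a root of a quadratic polynomial over it. A symmetric matrix can satisfy such a quadratic
  relation on a vector only if the discriminant is nonnegative (\<open>eigenvector_of_quadratic\<close>), so the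
  quadratic polynomial splits.
\<close>

hide_const (open) UnivPoly.coeff UnivPoly.monom Polynomials.degree Polynomials.lead_coeff

section \<open>Polynomials evaluated at a matrix\<close>

definition poly_mat :: "'b::comm_ring_1 poly \<Rightarrow> 'b mat \<Rightarrow> 'b mat" where
  "poly_mat p T = mat (dim_row T) (dim_row T)
     (\<lambda>ij. \<Sum>k\<le>degree p. coeff p k * (T ^\<^sub>m k) $$ ij)"

lemma poly_mat_carrier [simp]: "T \<in> carrier_mat n n \<Longrightarrow> poly_mat p T \<in> carrier_mat n n"
  by (simp add: poly_mat_def)

lemma poly_mat_dim [simp]: "dim_row (poly_mat p T) = dim_row T" "dim_col (poly_mat p T) = dim_row T"
  by (simp_all add: poly_mat_def)

text \<open>Any bound on the degree will do for the range of summation; this lets polynomials of different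
  degrees be compared term by term.\<close>

lemma poly_mat_index:
  assumes "T \<in> carrier_mat n n" "i < n" "j < n" "degree p \<le> N"
  shows "poly_mat p T $$ (i, j) = (\<Sum>k\<le>N. coeff p k * (T ^\<^sub>m k) $$ (i, j))"
proof -
  have "(\<Sum>k\<le>N. coeff p k * (T ^\<^sub>m k) $$ (i, j)) = (\<Sum>k\<le>degree p. coeff p k * (T ^\<^sub>m k) $$ (i, j))"
    using assms(4) by (intro sum.mono_neutral_right) (auto simp: coeff_eq_0)
  then show ?thesis using assms by (simp add: poly_mat_def)
qed

lemma poly_mat_0 [simp]: "T \<in> carrier_mat n n \<Longrightarrow> poly_mat 0 T = 0\<^sub>m n n"
  by (rule eq_matI) (auto simp: poly_mat_def)

lemma poly_mat_1 [simp]: "T \<in> carrier_mat n n \<Longrightarrow> poly_mat 1 T = 1\<^sub>m n"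
  by (rule eq_matI) (auto simp: poly_mat_def)

lemma poly_mat_add:
  assumes T: "T \<in> carrier_mat n n"
  shows "poly_mat (p + q) T = poly_mat p T + poly_mat q T"
proof (rule eq_matI)
  fix i j assume "i < dim_row (poly_mat p T + poly_mat q T)" "j < dim_col (poly_mat p T + poly_mat q T)"
  then have ij: "i < n" "j < n" using T by (auto simp: poly_mat_def)
  let ?N = "max (degree p) (degree q)"
  have "degree (p + q) \<le> ?N" by (simp add: degree_add_le_max)
  then show "poly_mat (p + q) T $$ (i, j) = (poly_mat p T + poly_mat q T) $$ (i, j)"
    using ij T poly_mat_index [OF T ij, of "p + q" ?N] poly_mat_index [OF T ij, of p ?N]
      poly_mat_index [OF T ij, of q ?N] poly_mat_carrier [OF T, of q]
    by (simp add: sum.distrib algebra_simps)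
qed (use T in \<open>auto simp: poly_mat_def\<close>)

lemma poly_mat_smult:
  assumes T: "T \<in> carrier_mat n n"
  shows "poly_mat (smult c p) T = c \<cdot>\<^sub>m poly_mat p T"
proof (rule eq_matI)
  fix i j assume "i < dim_row (c \<cdot>\<^sub>m poly_mat p T)" "j < dim_col (c \<cdot>\<^sub>m poly_mat p T)"
  then have ij: "i < n" "j < n" using T by (auto simp: poly_mat_def)
  show "poly_mat (smult c p) T $$ (i, j) = (c \<cdot>\<^sub>m poly_mat p T) $$ (i, j)"
    using ij T poly_mat_index [OF T ij, of "smult c p" "degree p"] poly_mat_index [OF T ij, of p "degree p"]
      poly_mat_carrier [OF T, of p]
    by (simp add: sum_distrib_left algebra_simps degree_smult_le)
qed (use T in \<open>auto simp: poly_mat_def\<close>)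

lemma poly_mat_pCons:
  assumes T: "T \<in> carrier_mat n n"
  shows "poly_mat (pCons a p) T = a \<cdot>\<^sub>m 1\<^sub>m n + poly_mat p T * T"
proof (rule eq_matI)
  fix i j assume "i < dim_row (a \<cdot>\<^sub>m 1\<^sub>m n + poly_mat p T * T)" "j < dim_col (a \<cdot>\<^sub>m 1\<^sub>m n + poly_mat p T * T)"
  then have ij: "i < n" "j < n" using T by auto
  have pw: "(T ^\<^sub>m k) \<in> carrier_mat n n" for k using T by simp
  have "poly_mat (pCons a p) T $$ (i, j) = (\<Sum>k\<le>Suc (degree p). coeff (pCons a p) k * (T ^\<^sub>m k) $$ (i, j))"
    by (rule poly_mat_index [OF T ij]) (simp add: degree_pCons_le)
  also have "\<dots> = a * (1\<^sub>m n) $$ (i, j) + (\<Sum>k\<le>degree p. coeff p k * (T ^\<^sub>m k * T) $$ (i, j))"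
    using T by (subst sum.atMost_Suc_shift) simp
  also have "(\<Sum>k\<le>degree p. coeff p k * (T ^\<^sub>m k * T) $$ (i, j))
      = (\<Sum>k\<le>degree p. \<Sum>l<n. coeff p k * (T ^\<^sub>m k) $$ (i, l) * T $$ (l, j))"
    using T ij pw by (simp add: scalar_prod_def atLeast0LessThan sum_distrib_left mult.assoc)
  also have "\<dots> = (\<Sum>l<n. poly_mat p T $$ (i, l) * T $$ (l, j))"
    using T ij by (subst sum.swap) (simp add: poly_mat_index [where n = n and N = "degree p"] sum_distrib_right)
  also have "\<dots> = (poly_mat p T * T) $$ (i, j)"
    using T ij poly_mat_carrier [OF T, of p] by (simp add: scalar_prod_def atLeast0LessThan)
  finally show "poly_mat (pCons a p) T $$ (i, j) = (a \<cdot>\<^sub>m 1\<^sub>m n + poly_mat p T * T) $$ (i, j)"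
    using T ij poly_mat_carrier [OF T, of p] by simp
qed (use T in \<open>auto simp: poly_mat_def\<close>)

lemma poly_mat_mult:
  assumes T: "T \<in> carrier_mat n n"
  shows "poly_mat (p * q) T = poly_mat p T * poly_mat q T"
proof (induction q)
  case 0
  show ?case using T poly_mat_carrier [OF T, of p] by simp
next
  case (pCons a q)
  note c = poly_mat_carrier [OF T]
  have "poly_mat (p * pCons a q) T = a \<cdot>\<^sub>m poly_mat p T + (0 \<cdot>\<^sub>m 1\<^sub>m n + (poly_mat p T * poly_mat q T) * T)"
    by (simp only: mult_pCons_right poly_mat_add [OF T] poly_mat_smult [OF T] poly_mat_pCons [OF T] pCons.IH)
  also have "\<dots> = a \<cdot>\<^sub>m poly_mat p T + poly_mat p T * (poly_mat q T * T)"
    by (simp only: assoc_mult_mat [OF c [of p] c [of q] T]) (use T in \<open>auto intro!: eq_matI\<close>)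
  also have "\<dots> = poly_mat p T * (a \<cdot>\<^sub>m 1\<^sub>m n + poly_mat q T * T)"
    using c [of p] c [of q] T
    by (subst mult_add_distrib_mat [of _ n n _ n]) (auto simp: mult_smult_distrib [of _ n n])
  finally show ?case by (simp only: poly_mat_pCons [OF T])
qed

lemma poly_mat_commute:
  assumes "T \<in> carrier_mat n n"
  shows "poly_mat p T * poly_mat q T = poly_mat q T * poly_mat p T"
  using poly_mat_mult [OF assms] by (metis mult.commute)

lemma poly_mat_linear:
  assumes T: "T \<in> carrier_mat n n"
  shows "poly_mat [:a, 1:] T = a \<cdot>\<^sub>m 1\<^sub>m n + T"
  using T by (simp add: poly_mat_pCons [OF T]) auto

text \<open>The \<open>n\<^sup>2 + 1\<close> matrices \<open>1, T, \<dots>, T ^ n\<^sup>2\<close> are linearly dependent, because they have only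
  \<open>n\<^sup>2\<close> entries each; the coefficients of a dependence form the polynomial.\<close>

lemma annihilating_poly_exists:
  fixes T :: "'b::field mat"
  assumes T: "T \<in> carrier_mat n n"
  shows "\<exists>p. p \<noteq> 0 \<and> poly_mat p T = 0\<^sub>m n n"
proof -
  let ?m = "Suc (n * n)"
  \<comment> \<open>Column \<open>k\<close> lists the entries of \<open>T ^ k\<close>. The extra zero row makes the matrix square and singular.\<close>
  define N where "N = mat ?m ?m (\<lambda>(r, k). if r < n * n then (T ^\<^sub>m k) $$ (r div n, r mod n) else 0)"
  have N: "N \<in> carrier_mat ?m ?m" by (simp add: N_def)
  have "transpose_mat N *\<^sub>v unit_vec ?m (n * n) = 0\<^sub>v ?m"
    by (rule eq_vecI) (auto simp: N_def)
  moreover have "unit_vec ?m (n * n) \<noteq> (0\<^sub>v ?m :: 'b vec)"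
    by (rule unit_vec_nonzero) simp
  ultimately have "det (transpose_mat N) = 0"
    using N by (subst det_0_iff_vec_prod_zero_field [of _ ?m]) (auto intro!: exI [of _ "unit_vec ?m (n * n)"])
  then have "det N = 0" using N by (simp add: det_transpose)
  then obtain c where c: "c \<in> carrier_vec ?m" "c \<noteq> 0\<^sub>v ?m" "N *\<^sub>v c = 0\<^sub>v ?m"
    using det_0_iff_vec_prod_zero_field [OF N] by blast
  define p where "p = (\<Sum>k\<le>n * n. monom (c $ k) k)"
  have cp: "coeff p k = (if k \<le> n * n then c $ k else 0)" for k
    by (simp add: p_def coeff_sum)
  have deg: "degree p \<le> n * n" by (rule degree_le) (simp add: cp)
  have "p \<noteq> 0"
  proof
    assume "p = 0"
    then have "c $ k = 0" if "k < ?m" for k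
      using cp [of k] that by auto
    then show False using c by auto
  qed
  moreover have "poly_mat p T = 0\<^sub>m n n"
  proof (rule eq_matI)
    fix i j assume "i < dim_row (0\<^sub>m n n :: 'b mat)" "j < dim_col (0\<^sub>m n n :: 'b mat)"
    then have ij: "i < n" "j < n" by auto
    let ?r = "i * n + j"
    have "Suc i * n \<le> n * n" using ij by (intro mult_right_mono) auto
    then have r: "?r < n * n" "?r div n = i" "?r mod n = j" using ij by auto
    have "poly_mat p T $$ (i, j) = (\<Sum>k\<le>n * n. c $ k * (T ^\<^sub>m k) $$ (i, j))"
      by (subst poly_mat_index [OF T ij deg]) (auto simp: cp intro!: sum.cong)
    also have "\<dots> = (\<Sum>k\<in>{0..<?m}. N $$ (?r, k) * c $ k)"
      using r by (intro sum.cong) (auto simp: N_def)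
    also have "\<dots> = (N *\<^sub>v c) $ ?r"
      using r N c by (subst index_mult_mat_vec) (auto simp: scalar_prod_def)
    also have "\<dots> = 0" using c r by simp
    finally show "poly_mat p T $$ (i, j) = 0\<^sub>m n n $$ (i, j)" using ij by simp
  qed (use T in \<open>auto simp: poly_mat_def\<close>)
  ultimately show ?thesis by blast
qed

text \<open>Multiply \<open>M\<close> by the factors \<open>T - d\<close> one at a time. The product is 0 in the end, so there is a
  last nonzero stage, and the factor that kills it shows that it consists of eigenvectors. Keeping that
  stage in the form of a polynomial in \<open>T\<close> times \<open>M\<close> preserves every relation that commutes with \<open>T\<close>.\<close>

lemma eigen_matrix_from_annihilator:
  fixes T :: "'b::field mat"
  assumes T: "T \<in> carrier_mat n n" and M: "M \<in> carrier_mat n n" and "M \<noteq> 0\<^sub>m n n"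
    and "poly_mat (\<Prod>d\<in>#A. [:- d, 1:]) T * M = 0\<^sub>m n n"
  shows "\<exists>d g. d \<in># A \<and> poly_mat g T * M \<noteq> 0\<^sub>m n n \<and> T * (poly_mat g T * M) = d \<cdot>\<^sub>m (poly_mat g T * M)"
  using assms(4)
proof (induction A)
  case empty
  then show ?case using assms by simp
next
  case (add d A)
  let ?Y = "poly_mat (\<Prod>d\<in>#A. [:- d, 1:]) T * M"
  show ?case
  proof (cases "?Y = 0\<^sub>m n n")
    case True
    then show ?thesis using add.IH by auto
  next
    case False
    note c = poly_mat_carrier [OF T]
    have Y: "?Y \<in> carrier_mat n n" by (rule mult_carrier_mat [OF c M])
    have "(- d \<cdot>\<^sub>m 1\<^sub>m n + T) * ?Y = 0\<^sub>m n n"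
      using add.prems
      by (simp add: poly_mat_mult [OF T] poly_mat_linear [OF T, symmetric] assoc_mult_mat [OF c c M]
          del: mult_pCons_left)
    then have *: "- d \<cdot>\<^sub>m ?Y + T * ?Y = 0\<^sub>m n n"
      using T Y by (simp add: add_mult_distrib_mat [of _ n n _ _ n] mult_smult_assoc_mat [of _ n n _ n])
    have "P = d \<cdot>\<^sub>m Q" if "- d \<cdot>\<^sub>m Q + P = 0\<^sub>m n n" "Q \<in> carrier_mat n n" "P \<in> carrier_mat n n" for P Q
      using that by (auto simp: mat_eq_iff)
    from this [OF * Y mult_carrier_mat [OF T Y]] have "T * ?Y = d \<cdot>\<^sub>m ?Y" .
    then show ?thesis using False by (intro exI [of _ d] exI [of _ "\<Prod>d\<in>#A. [:- d, 1:]"]) auto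
  qed
qed

lemma poly_mat_hom:
  assumes "comm_ring_hom h" and T: "T \<in> carrier_mat n n"
  shows "poly_mat (map_poly h p) (map_mat h T) = map_mat h (poly_mat p T)"
proof (rule eq_matI)
  interpret comm_ring_hom h by fact
  fix i j assume "i < dim_row (map_mat h (poly_mat p T))" "j < dim_col (map_mat h (poly_mat p T))"
  then have ij: "i < n" "j < n" using poly_mat_carrier [OF T, of p] by auto
  have pw: "(T ^\<^sub>m k) \<in> carrier_mat n n" for k using T by simp
  have "poly_mat (map_poly h p) (map_mat h T) $$ (i, j)
      = (\<Sum>k\<le>degree p. coeff (map_poly h p) k * (map_mat h T ^\<^sub>m k) $$ (i, j))"
    using T ij by (intro poly_mat_index [of _ n]) (auto simp: degree_map_poly_le)
  also have "\<dots> = h (poly_mat p T $$ (i, j))"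
    using ij T pw by (simp add: poly_mat_index [of T n i j p "degree p"] hom_sum hom_mult coeff_map_poly_hom
        mat_hom_pow [OF T, symmetric])
  finally show "poly_mat (map_poly h p) (map_mat h T) $$ (i, j) = map_mat h (poly_mat p T) $$ (i, j)"
    using ij T by simp
qed (use T in \<open>auto simp: poly_mat_def\<close>)

section \<open>Eigenvectors of symmetric matrices\<close>

text \<open>Let \<open>S = t + T\<close>, so that \<open>S B S = \<mu> B\<close>. Polynomials in \<open>T\<close> commute with \<open>S\<close>, so \<open>B\<close> may first be
  replaced by some \<open>Y\<close> with \<open>T Y = d Y\<close> and then, after transposition, by some \<open>Z\<close> with
  \<open>T Z = d' Z\<close>. On \<open>Z\<close> the relation becomes multiplication by \<open>(t + d) (t + d')\<close>.\<close>

lemma eigenvalue_pair_of_congruence: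
  fixes T :: "'b::field mat"
  assumes T: "T \<in> carrier_mat n n" and sym: "transpose_mat T = T"
    and ann: "poly_mat (\<Prod>d\<in>#A. [:- d, 1:]) T = 0\<^sub>m n n"
    and B: "B \<in> carrier_mat n n" "B \<noteq> 0\<^sub>m n n"
    and cong: "(t \<cdot>\<^sub>m 1\<^sub>m n + T) * B * (t \<cdot>\<^sub>m 1\<^sub>m n + T) = \<mu> \<cdot>\<^sub>m B"
  shows "\<exists>d d'. d \<in># A \<and> d' \<in># A \<and> (t + d) * (t + d') = \<mu> \<and>
    (\<exists>Y. Y \<in> carrier_mat n n \<and> Y \<noteq> 0\<^sub>m n n \<and> T * Y = d \<cdot>\<^sub>m Y)"
proof -
  define S where "S = t \<cdot>\<^sub>m 1\<^sub>m n + T"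
  note c = poly_mat_carrier [OF T]
  note assoc = assoc_mult_mat [of _ n n _ n _ n] mult_carrier_mat [of _ n n _ n]
  have S: "S \<in> carrier_mat n n" using T by (simp add: S_def)
  have Spoly: "S = poly_mat [:t, 1:] T" by (simp add: S_def poly_mat_linear [OF T])
  have comm: "S * poly_mat g T = poly_mat g T * S" for g
    unfolding Spoly by (rule poly_mat_commute [OF T])
  have symS: "transpose_mat S = S"
    using T by (simp add: S_def sym transpose_add [of _ n n]) (auto intro!: eq_matI)
  have shift: "S * M = (t + d) \<cdot>\<^sub>m M" if "M \<in> carrier_mat n n" "T * M = d \<cdot>\<^sub>m M" for M d
    using that T by (simp add: S_def add_mult_distrib_mat [of _ n n _ _ n] mult_smult_assoc_mat [of _ n n _ n]
        add_smult_distrib_right_mat [of _ n n])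
  obtain d g where d: "d \<in># A" and Y0: "poly_mat g T * B \<noteq> 0\<^sub>m n n"
    and TY: "T * (poly_mat g T * B) = d \<cdot>\<^sub>m (poly_mat g T * B)"
    using eigen_matrix_from_annihilator [OF T B, of A] ann B by auto
  define Y where "Y = poly_mat g T * B"
  have Y: "Y \<in> carrier_mat n n" unfolding Y_def by (rule mult_carrier_mat [OF c B(1)])
  have "S * Y * S = poly_mat g T * (S * B * S)"
  proof -
    have "S * Y * S = (S * poly_mat g T) * B * S" using S c [of g] B by (simp add: Y_def assoc)
    also have "\<dots> = poly_mat g T * (S * B * S)" unfolding comm using S c [of g] B by (simp add: assoc)
    finally show ?thesis .
  qed
  also have "\<dots> = \<mu> \<cdot>\<^sub>m Y"
    using cong c [of g] B by (simp add: S_def [symmetric] Y_def mult_smult_distrib [of _ n n])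
  finally have SYS: "(t + d) \<cdot>\<^sub>m (Y * S) = \<mu> \<cdot>\<^sub>m Y"
    using shift [OF Y TY [folded Y_def]] S Y by (simp add: mult_smult_assoc_mat [of _ n n _ n])
  have YT: "transpose_mat Y \<in> carrier_mat n n" using Y by simp
  have YT0: "transpose_mat Y \<noteq> 0\<^sub>m n n"
    using Y0 [folded Y_def] zero_transpose_mat [of n n] by (metis transpose_transpose)
  obtain d' g' where d': "d' \<in># A" and Z0: "poly_mat g' T * transpose_mat Y \<noteq> 0\<^sub>m n n"
    and TZ: "T * (poly_mat g' T * transpose_mat Y) = d' \<cdot>\<^sub>m (poly_mat g' T * transpose_mat Y)"
    using eigen_matrix_from_annihilator [OF T YT YT0, of A] ann YT by auto
  define Z where "Z = poly_mat g' T * transpose_mat Y"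
  have Z: "Z \<in> carrier_mat n n" unfolding Z_def by (rule mult_carrier_mat [OF c YT])
  have "transpose_mat ((t + d) \<cdot>\<^sub>m (Y * S)) = (t + d) \<cdot>\<^sub>m (S * transpose_mat Y)"
    using transpose_mult [OF Y S] symS by (auto intro!: eq_matI simp: mat_eq_iff)
  moreover have "transpose_mat (\<mu> \<cdot>\<^sub>m Y) = \<mu> \<cdot>\<^sub>m transpose_mat Y"
    by (auto intro!: eq_matI)
  ultimately have SYT: "(t + d) \<cdot>\<^sub>m (S * transpose_mat Y) = \<mu> \<cdot>\<^sub>m transpose_mat Y"
    using SYS by simp
  have "(t + d) \<cdot>\<^sub>m (S * Z) = poly_mat g' T * ((t + d) \<cdot>\<^sub>m (S * transpose_mat Y))"
  proof -
    have "S * Z = (S * poly_mat g' T) * transpose_mat Y" using S c [of g'] YT by (simp add: Z_def assoc)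
    also have "\<dots> = poly_mat g' T * (S * transpose_mat Y)" unfolding comm using S c [of g'] YT by (simp add: assoc)
    finally show ?thesis using S c [of g'] YT by (simp add: mult_smult_distrib [of _ n n _ n] assoc)
  qed
  also have "\<dots> = \<mu> \<cdot>\<^sub>m Z"
    unfolding SYT using c [of g'] YT by (simp add: Z_def mult_smult_distrib [of _ n n])
  finally have eq: "((t + d) * (t + d')) \<cdot>\<^sub>m Z = \<mu> \<cdot>\<^sub>m Z"
    using shift [OF Z TZ [folded Z_def]] Z by (auto intro!: eq_matI simp: mat_eq_iff mult.assoc)
  obtain i j where ij: "i < n" "j < n" "Z $$ (i, j) \<noteq> 0"
    using Z0 [folded Z_def] Z by (auto simp: mat_eq_iff)
  have "(((t + d) * (t + d')) \<cdot>\<^sub>m Z) $$ (i, j) = (\<mu> \<cdot>\<^sub>m Z) $$ (i, j)" using eq by simp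
  then have "(t + d) * (t + d') = \<mu>" using ij Z by simp
  then show ?thesis using d d' Y Y0 [folded Y_def] TY [folded Y_def] by blast
qed

lemma sum_square_split:
  fixes f :: "nat \<Rightarrow> nat \<Rightarrow> 'b::comm_monoid_add"
  shows "(\<Sum>k<n. \<Sum>l<n. f k l) = (\<Sum>k<n. \<Sum>l<k. f k l + f l k) + (\<Sum>k<n. f k k)"
  by (induction n) (simp_all add: sum.distrib ac_simps)

text \<open>The map \<open>B \<mapsto> S B S\<close> preserves the antisymmetric matrices. These are determined by their
  \<open>n (n - 1) / 2\<close> entries below the diagonal, and in these coordinates the map is given by the matrix
  \<open>C\<close> of 2 by 2 minors of \<open>S\<close>, which is symmetric if \<open>S\<close> is. Passing from all
  \<open>B\<close> to the antisymmetric ones is what gives a dimension with one factor 2 less than \<open>n\<close>, if \<open>n\<close> is even.\<close>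

lemma second_compound_eigenvector:
  fixes S :: "'b::comm_ring_1 mat"
  assumes S: "S \<in> carrier_mat n n" and sym: "transpose_mat S = S" and m: "m = (\<Sum>l<n. l)"
    and eig: "\<And>C :: 'b mat. C \<in> carrier_mat m m \<Longrightarrow> transpose_mat C = C \<Longrightarrow>
      \<exists>\<mu> x. x \<in> carrier_vec m \<and> x \<noteq> 0\<^sub>v m \<and> C *\<^sub>v x = \<mu> \<cdot>\<^sub>v x"
  shows "\<exists>\<mu> B. B \<in> carrier_mat n n \<and> B \<noteq> 0\<^sub>m n n \<and> S * B * S = \<mu> \<cdot>\<^sub>m B"
proof -
  \<comment> \<open>A pair \<open>(k, l)\<close> in \<open>I\<close> has \<open>l < k\<close>: it is a position below the diagonal, and \<open>e\<close> numbers these positions.\<close>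
  define I where "I = (SIGMA l:{..<n}. {..<l})"
  have "finite I" "card I = m" by (simp_all add: I_def m)
  then obtain e where e: "bij_betw e {0..<m} I" using ex_bij_betw_nat_finite by blast
  define g where "g = inv_into {0..<m} e"
  have ge: "g (e a) = a" if "a < m" for a
    using that e by (simp add: g_def bij_betw_inv_into_left)
  have eg: "e (g q) = q" "g q < m" if "q \<in> I" for q
    using that e bij_betw_inv_into_right [OF e that] bij_betw_apply [OF bij_betw_inv_into [OF e] that]
    by (auto simp: g_def)
  have eI: "e a \<in> I" if "a < m" for a using e that by (auto simp: bij_betw_def)
  define minor where "minor = (\<lambda>(i, j) (k, l). S $$ (i, k) * S $$ (j, l) - S $$ (i, l) * S $$ (j, k))"
  have symS: "S $$ (i, j) = S $$ (j, i)" if "i < n" "j < n" for i j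
    using that S arg_cong [OF sym, of "\<lambda>M. M $$ (i, j)"] by simp
  define C where "C = mat m m (\<lambda>(a, b). minor (e a) (e b))"
  have C: "C \<in> carrier_mat m m" by (simp add: C_def)
  have "minor (e a) (e b) = minor (e b) (e a)" if "a < m" "b < m" for a b
  proof -
    obtain i j k l where *: "e a = (i, j)" "e b = (k, l)" by fastforce
    then have "i < n" "j < n" "k < n" "l < n" using eI [OF that(1)] eI [OF that(2)] by (auto simp: I_def)
    then show ?thesis using symS by (simp add: * minor_def)
  qed
  then have "transpose_mat C = C" by (auto simp: C_def intro!: eq_matI)
  then obtain \<mu> x where x: "x \<in> carrier_vec m" "x \<noteq> 0\<^sub>v m" "C *\<^sub>v x = \<mu> \<cdot>\<^sub>v x"
    using eig [OF C] by blast
  define b where "b = (\<lambda>k l. if l < k then x $ g (k, l) else if k < l then - x $ g (l, k) else 0)"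
  define B where "B = mat n n (\<lambda>(k, l). b k l)"
  have B: "B \<in> carrier_mat n n" by (simp add: B_def)
  have SBS: "(S * B * S) $$ (i, j) = (\<Sum>a<m. minor (i, j) (e a) * x $ a)" if ij: "i < n" "j < n" for i j
  proof -
    have "(S * B * S) $$ (i, j) = (\<Sum>l<n. \<Sum>k<n. S $$ (i, k) * b k l * S $$ (l, j))"
      using ij S B by (simp add: scalar_prod_def atLeast0LessThan sum_distrib_right B_def)
    also have "\<dots> = (\<Sum>k<n. \<Sum>l<n. S $$ (i, k) * b k l * S $$ (l, j))" by (rule sum.swap)
    also have "\<dots> = (\<Sum>k<n. \<Sum>l<k. S $$ (i, k) * b k l * S $$ (l, j) + S $$ (i, l) * b l k * S $$ (k, j))"
      by (subst sum_square_split) (simp add: b_def)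
    also have "\<dots> = (\<Sum>k<n. \<Sum>l<k. minor (i, j) (k, l) * x $ g (k, l))"
      using ij by (intro sum.cong refl) (auto simp: b_def minor_def symS [of _ j] algebra_simps)
    also have "\<dots> = (\<Sum>q\<in>I. minor (i, j) q * x $ g q)"
      by (simp add: I_def sum.Sigma split_def)
    also have "\<dots> = (\<Sum>a\<in>{0..<m}. minor (i, j) (e a) * x $ g (e a))"
      by (rule sum.reindex_bij_betw [OF e, symmetric])
    also have "\<dots> = (\<Sum>a<m. minor (i, j) (e a) * x $ a)"
      by (intro sum.cong) (auto simp: ge)
    finally show ?thesis .
  qed
  have on_I: "(\<Sum>a<m. minor (i, j) (e a) * x $ a) = \<mu> * x $ g (i, j)" if "j < i" "i < n" for i j
  proof -
    have q: "(i, j) \<in> I" using that by (simp add: I_def)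
    have "(C *\<^sub>v x) $ g (i, j) = (\<Sum>a<m. minor (i, j) (e a) * x $ a)"
      using eg [OF q] x(1) C by (simp add: scalar_prod_def atLeast0LessThan C_def)
    then show ?thesis using x eg [OF q] by simp
  qed
  have "S * B * S = \<mu> \<cdot>\<^sub>m B"
  proof (rule eq_matI)
    fix i j assume "i < dim_row (\<mu> \<cdot>\<^sub>m B)" "j < dim_col (\<mu> \<cdot>\<^sub>m B)"
    then have ij: "i < n" "j < n" using B by auto
    have "minor (i, j) q = - minor (j, i) q" for q by (cases q) (simp add: minor_def)
    then have flip: "(\<Sum>a<m. minor (i, j) (e a) * x $ a) = - (\<Sum>a<m. minor (j, i) (e a) * x $ a)"
      by (simp add: sum_negf)
    have "i = j \<Longrightarrow> minor (i, j) q = 0" for q by (cases q) (simp add: minor_def algebra_simps)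
    then have "(\<Sum>a<m. minor (i, j) (e a) * x $ a) = \<mu> * b i j"
      using on_I [of j i] on_I [of i j] flip ij by (cases i j rule: linorder_cases) (auto simp: b_def)
    then show "(S * B * S) $$ (i, j) = (\<mu> \<cdot>\<^sub>m B) $$ (i, j)"
      using SBS [OF ij] ij by (simp add: B_def)
  qed (use S B in auto)
  moreover have "B \<noteq> 0\<^sub>m n n"
  proof
    assume B0: "B = 0\<^sub>m n n"
    have "x $ a = 0" if a: "a < m" for a
    proof -
      obtain k l where kl: "e a = (k, l)" by fastforce
      with eI [OF a] have "l < k" "k < n" by (auto simp: I_def)
      then have "x $ g (k, l) = B $$ (k, l)" by (simp add: B_def b_def)
      then show ?thesis using ge [OF a] kl B0 \<open>l < k\<close> \<open>k < n\<close> by simp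
    qed
    then show False using x by auto
  qed
  ultimately show ?thesis using B by blast
qed

lemma scalar_prod_self_nonneg:
  fixes v :: "'a::linordered_field vec"
  shows "0 \<le> v \<bullet> v"
  by (auto simp: scalar_prod_def intro!: sum_nonneg)

lemma scalar_prod_self_eq_0_iff:
  fixes v :: "'a::linordered_field vec"
  assumes "v \<in> carrier_vec n"
  shows "v \<bullet> v = 0 \<longleftrightarrow> v = 0\<^sub>v n"
  using assms by (auto simp: scalar_prod_def sum_nonneg_eq_0_iff)

lemma symmetric_scalar_prod:
  fixes T :: "'b::comm_ring_1 mat"
  assumes "T \<in> carrier_mat n n" "transpose_mat T = T" "u \<in> carrier_vec n" "v \<in> carrier_vec n"
  shows "(T *\<^sub>v u) \<bullet> v = u \<bullet> (T *\<^sub>v v)"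
  using transpose_vec_mult_scalar [of T n n v u] assms
  by (metis comm_scalar_prod mult_mat_vec_carrier)

text \<open>Completing the square, \<open>w = T v - (a / 2) v\<close> has \<open>w \<bullet> w = (a\<^sup>2 / 4 - b) (v \<bullet> v)\<close> because \<open>T\<close> is
  self-adjoint. Hence \<open>a\<^sup>2 / 4 - b\<close> is nonnegative and has a square root \<open>c\<close>, so the quadratic polynomial
  factors over the base field: either \<open>v\<close> or \<open>T v - (a / 2 + c) v\<close> is an eigenvector.\<close>

lemma eigenvector_of_quadratic:
  fixes T :: "'a::real_closed_field mat"
  assumes T: "T \<in> carrier_mat n n" and sym: "transpose_mat T = T"
    and v: "v \<in> carrier_vec n" "v \<noteq> 0\<^sub>v n"
    and quad: "T *\<^sub>v (T *\<^sub>v v) = a \<cdot>\<^sub>v (T *\<^sub>v v) - b \<cdot>\<^sub>v v"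
  shows "\<exists>\<mu> x. x \<in> carrier_vec n \<and> x \<noteq> 0\<^sub>v n \<and> T *\<^sub>v x = \<mu> \<cdot>\<^sub>v x"
proof -
  define u where "u = T *\<^sub>v v"
  have u: "u \<in> carrier_vec n" using T v by (simp add: u_def)
  have Tu: "T *\<^sub>v u = a \<cdot>\<^sub>v u - b \<cdot>\<^sub>v v" using quad by (simp add: u_def)
  define w where "w = u - (a / 2) \<cdot>\<^sub>v v"
  have "u \<bullet> u = v \<bullet> (T *\<^sub>v u)"
    using symmetric_scalar_prod [OF T sym v(1) u] by (simp add: u_def)
  also have "\<dots> = a * (v \<bullet> u) - b * (v \<bullet> v)"
    using u v by (simp add: Tu scalar_prod_minus_distrib [of _ n])
  finally have uu: "u \<bullet> u = a * (v \<bullet> u) - b * (v \<bullet> v)" .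
  have "w \<bullet> w = u \<bullet> u - (a / 2) * (v \<bullet> u) - (a / 2) * (v \<bullet> u) + (a / 2) * (a / 2) * (v \<bullet> v)"
    using u v comm_scalar_prod [OF u v(1)]
    by (simp add: w_def scalar_prod_minus_distrib [of _ n] minus_scalar_prod_distrib [of _ n] algebra_simps)
  also have "\<dots> = (a / 2 * (a / 2) - b) * (v \<bullet> v)"
    unfolding uu by (simp add: field_simps)
  finally have "0 \<le> (a / 2 * (a / 2) - b) * (v \<bullet> v)"
    using scalar_prod_self_nonneg [of w] by simp
  moreover have "0 < v \<bullet> v"
    using scalar_prod_self_nonneg [of v] scalar_prod_self_eq_0_iff [OF v(1)] v(2) by (simp add: less_le)
  ultimately have "0 \<le> a / 2 * (a / 2) - b"
    by (simp add: zero_le_mult_iff)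
  then obtain c where c: "c * c = a / 2 * (a / 2) - b" using nonneg_is_square by blast
  define x where "x = u - (a / 2 + c) \<cdot>\<^sub>v v"
  have x: "x \<in> carrier_vec n" using u v by (simp add: x_def)
  show ?thesis
  proof (cases "x = 0\<^sub>v n")
    case True
    have "u = (a / 2 + c) \<cdot>\<^sub>v v"
    proof (rule eq_vecI)
      fix i assume "i < dim_vec ((a / 2 + c) \<cdot>\<^sub>v v)"
      then have "i < n" using v by simp
      moreover from this have "x $ i = 0" using True by simp
      ultimately show "u $ i = ((a / 2 + c) \<cdot>\<^sub>v v) $ i" using u v by (simp add: x_def)
    qed (use u v in auto)
    then show ?thesis using v by (auto simp: u_def)
  next
    case False
    have prod: "(a / 2 - c) * (a / 2 + c) = b" using c by (simp add: algebra_simps)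
    have "T *\<^sub>v x = T *\<^sub>v u - (a / 2 + c) \<cdot>\<^sub>v u"
      using T u v by (simp add: x_def mult_minus_distrib_mat_vec [of _ n n] mult_mat_vec [of _ n n] u_def)
    also have "\<dots> = (a / 2 - c) \<cdot>\<^sub>v x"
    proof (rule eq_vecI)
      fix i assume "i < dim_vec ((a / 2 - c) \<cdot>\<^sub>v x)"
      then have i: "i < n" using x by simp
      have "((a / 2 - c) \<cdot>\<^sub>v x) $ i = (a / 2 - c) * u $ i - ((a / 2 - c) * (a / 2 + c)) * v $ i"
        using i u v by (simp add: x_def right_diff_distrib mult.assoc)
      also have "\<dots> = (a / 2 - c) * u $ i - b * v $ i" by (simp only: prod)
      finally show "(T *\<^sub>v u - (a / 2 + c) \<cdot>\<^sub>v u) $ i = ((a / 2 - c) \<cdot>\<^sub>v x) $ i"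
        using i u v by (simp add: Tu field_simps)
    qed (use u x in auto)
    finally show ?thesis using x False by blast
  qed
qed

lemma to_ac_hom: "inj_comm_ring_hom (to_ac :: 'a::field \<Rightarrow> 'a alg_closure)"
  by unfold_locales auto

text \<open>The even step of Laplace's argument. For each natural number \<open>t\<close> the second compound of \<open>T + t\<close>
  has an eigenvalue in the base field, and it equals \<open>(t + d) (t + d')\<close> for two eigenvalues of \<open>T\<close> in
  the algebraic closure. Two values of \<open>t\<close> with the same pair give two linear equations that express
  \<open>d + d'\<close> and \<open>d d'\<close> through elements of the base field.\<close>

lemma symmetric_eigenvector_if_compound:
  fixes T :: "'a::real_closed_field mat"
  assumes T: "T \<in> carrier_mat n n" and sym: "transpose_mat T = T" and n: "0 < n" and m: "m = (\<Sum>l<n. l)"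
    and eig: "\<And>C :: 'a mat. C \<in> carrier_mat m m \<Longrightarrow> transpose_mat C = C \<Longrightarrow>
      \<exists>\<mu> x. x \<in> carrier_vec m \<and> x \<noteq> 0\<^sub>v m \<and> C *\<^sub>v x = \<mu> \<cdot>\<^sub>v x"
  shows "\<exists>\<mu> x. x \<in> carrier_vec n \<and> x \<noteq> 0\<^sub>v n \<and> T *\<^sub>v x = \<mu> \<cdot>\<^sub>v x"
proof -
  interpret h: inj_comm_ring_hom "to_ac :: 'a \<Rightarrow> 'a alg_closure" by (rule to_ac_hom)
  define L where "L = map_mat (to_ac :: 'a \<Rightarrow> 'a alg_closure) T"
  have L: "L \<in> carrier_mat n n" using T by (simp add: L_def)
  have symL: "transpose_mat L = L" by (simp add: L_def map_mat_transpose sym)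
  obtain p where p: "p \<noteq> 0" "poly_mat p T = 0\<^sub>m n n" using annihilating_poly_exists [OF T] by blast
  define q where "q = map_poly (to_ac :: 'a \<Rightarrow> 'a alg_closure) p"
  have "q \<noteq> 0" using p by (simp add: q_def)
  then obtain A where A: "q = Polynomial.smult (lead_coeff q) (\<Prod>d\<in>#A. [:- d, 1:])"
    using alg_closed_imp_factorization [of q] by blast
  have "poly_mat q L = 0\<^sub>m n n"
    using poly_mat_hom [OF h.comm_ring_hom_axioms T, of p] p(2)
    by (simp add: q_def L_def) (auto intro!: eq_matI)
  then have "lead_coeff q \<cdot>\<^sub>m poly_mat (\<Prod>d\<in>#A. [:- d, 1:]) L = 0\<^sub>m n n"
    using A poly_mat_smult [OF L] by metis
  then have ann: "poly_mat (\<Prod>d\<in>#A. [:- d, 1:]) L = 0\<^sub>m n n"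
    using \<open>q \<noteq> 0\<close> L by (auto simp: mat_eq_iff)
  define good where "good = (\<lambda>t (d, d'). d \<in># A \<and> d' \<in># A \<and>
      (\<exists>\<mu>. (of_nat t + d) * (of_nat t + d') = to_ac \<mu>) \<and>
      (\<exists>Y. Y \<in> carrier_mat n n \<and> Y \<noteq> 0\<^sub>m n n \<and> L * Y = d \<cdot>\<^sub>m Y))"
  have "\<exists>dd. good t dd" for t
  proof -
    define S where "S = of_nat t \<cdot>\<^sub>m 1\<^sub>m n + T"
    have S: "S \<in> carrier_mat n n" using T by (simp add: S_def)
    have "transpose_mat S = S"
      using T by (simp add: S_def sym transpose_add [of _ n n]) (auto intro!: eq_matI)
    then obtain \<mu> B where B: "B \<in> carrier_mat n n" "B \<noteq> 0\<^sub>m n n" and SBS: "S * B * S = \<mu> \<cdot>\<^sub>m B"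
      using second_compound_eigenvector [OF S _ m eig] by blast
    have hS: "map_mat to_ac S = of_nat t \<cdot>\<^sub>m 1\<^sub>m n + L"
      using T by (auto simp: S_def L_def intro!: eq_matI)
    have "map_mat to_ac (S * B * S) = map_mat to_ac S * map_mat to_ac B * map_mat to_ac S"
      using S B by (simp add: h.mat_hom_mult [of _ n n _ n])
    moreover have "map_mat to_ac (\<mu> \<cdot>\<^sub>m B) = to_ac \<mu> \<cdot>\<^sub>m map_mat to_ac B"
      by (auto intro!: eq_matI)
    ultimately have "(of_nat t \<cdot>\<^sub>m 1\<^sub>m n + L) * map_mat to_ac B * (of_nat t \<cdot>\<^sub>m 1\<^sub>m n + L)
        = to_ac \<mu> \<cdot>\<^sub>m map_mat to_ac B"
      using SBS by (simp add: hS)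
    moreover have "map_mat to_ac B \<noteq> (0\<^sub>m n n :: 'a alg_closure mat)"
      using B by (auto simp: mat_eq_iff)
    ultimately have "\<exists>d d'. d \<in># A \<and> d' \<in># A \<and> (of_nat t + d) * (of_nat t + d') = to_ac \<mu> \<and>
        (\<exists>Y. Y \<in> carrier_mat n n \<and> Y \<noteq> 0\<^sub>m n n \<and> L * Y = d \<cdot>\<^sub>m Y)"
      using B(1) by (intro eigenvalue_pair_of_congruence [OF L symL ann]) auto
    then show ?thesis unfolding good_def by blast
  qed
  then obtain f where f: "\<And>t. good t (f t)" by metis
  have "f t \<in> set_mset A \<times> set_mset A" for t
    using f [of t] by (cases "f t") (simp add: good_def)
  then have "range f \<subseteq> set_mset A \<times> set_mset A" by blast
  then have "finite (range f)" by (rule finite_subset) simp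
  then have "\<not> inj f" using finite_imageD infinite_UNIV_nat by blast
  then obtain s t where st: "s \<noteq> t" "f s = f t" by (auto simp: inj_def)
  obtain d d' where dd: "f s = (d, d')" by fastforce
  have "good s (d, d')" "good t (d, d')" using f [of s] f [of t] st dd by auto
  then obtain \<mu> \<nu> Y where mu: "(of_nat s + d) * (of_nat s + d') = to_ac \<mu>"
    and nu: "(of_nat t + d) * (of_nat t + d') = to_ac \<nu>"
    and Y: "Y \<in> carrier_mat n n" "Y \<noteq> 0\<^sub>m n n" "L * Y = d \<cdot>\<^sub>m Y"
    by (auto simp: good_def)
  \<comment> \<open>Subtracting the two relations gives \<open>\<mu> - \<nu> = (s - t) (d + d' + s + t)\<close>; solve it for \<open>d + d'\<close>.\<close>
  define a where "a = (\<mu> - \<nu>) / (of_nat s - of_nat t) - of_nat s - of_nat t"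
  have st0: "of_nat s - of_nat t \<noteq> (0 :: 'a)" "of_nat s - of_nat t \<noteq> (0 :: 'a alg_closure)"
    using st by auto
  have "to_ac \<mu> - to_ac \<nu> = (of_nat s - of_nat t) * (d + d' + of_nat s + of_nat t)"
    unfolding mu [symmetric] nu [symmetric] by (simp add: algebra_simps)
  then have a: "to_ac a = d + d'" using st0 by (simp add: a_def field_simps)
  define b where "b = \<mu> - of_nat s * a - of_nat s * of_nat s"
  have b: "to_ac b = d * d'" by (simp add: b_def a mu [symmetric] algebra_simps)
  \<comment> \<open>\<open>Q\<close> is singular over the algebraic closure, hence singular, because its determinant is the same there.\<close>
  define Q where "Q = T * T - a \<cdot>\<^sub>m T + b \<cdot>\<^sub>m 1\<^sub>m n"
  have Q: "Q \<in> carrier_mat n n" using T by (simp add: Q_def)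
  have "map_mat to_ac Q = L * L - to_ac a \<cdot>\<^sub>m L + to_ac b \<cdot>\<^sub>m 1\<^sub>m n"
  proof -
    have "map_mat to_ac (T * T) = L * L" by (simp add: L_def h.mat_hom_mult [OF T T])
    then have "to_ac ((T * T) $$ (i, j)) = (L * L) $$ (i, j)" if "i < n" "j < n" for i j
      using that T by (metis index_map_mat(1) index_mult_mat(2,3) carrier_matD)
    then show ?thesis
      using T L by (intro eq_matI) (auto simp: Q_def L_def simp del: index_mult_mat(1))
  qed
  moreover have "(L * L - to_ac a \<cdot>\<^sub>m L + to_ac b \<cdot>\<^sub>m 1\<^sub>m n) * Y = 0\<^sub>m n n"
  proof -
    have "(L * L - to_ac a \<cdot>\<^sub>m L + to_ac b \<cdot>\<^sub>m 1\<^sub>m n) * Y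
        = L * (L * Y) - to_ac a \<cdot>\<^sub>m (L * Y) + to_ac b \<cdot>\<^sub>m Y"
      using L Y(1) by (simp add: add_mult_distrib_mat [of _ n n _ _ n] minus_mult_distrib_mat [of _ n n _ _ n]
          mult_smult_assoc_mat [of _ n n _ n] minus_carrier_mat)
    also have "L * (L * Y) = d \<cdot>\<^sub>m (d \<cdot>\<^sub>m Y)"
      using Y L by (simp add: mult_smult_distrib [of _ n n _ n])
    also have "d \<cdot>\<^sub>m (d \<cdot>\<^sub>m Y) - to_ac a \<cdot>\<^sub>m (L * Y) + to_ac b \<cdot>\<^sub>m Y = 0\<^sub>m n n"
      unfolding Y(3) using Y(1) by (intro eq_matI) (auto simp: a b algebra_simps)
    finally show ?thesis .
  qed
  ultimately have QY: "map_mat to_ac Q * Y = 0\<^sub>m n n" by simp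
  obtain j where j: "j < n" "col Y j \<noteq> 0\<^sub>v n"
  proof -
    obtain i j where "i < n" "j < n" "Y $$ (i, j) \<noteq> 0" using Y by (auto simp: mat_eq_iff)
    then have "col Y j $ i \<noteq> 0\<^sub>v n $ i" using Y by simp
    then show ?thesis using that [OF \<open>j < n\<close>] by metis
  qed
  have "map_mat to_ac Q *\<^sub>v col Y j = col (map_mat to_ac Q * Y) j"
    using Q Y j by (intro col_mult2 [symmetric, of _ n n _ n]) auto
  then have "map_mat to_ac Q *\<^sub>v col Y j = 0\<^sub>v n" using QY j by simp
  then have "det (map_mat (to_ac :: 'a \<Rightarrow> 'a alg_closure) Q) = 0"
    using Q Y j by (subst det_0_iff_vec_prod_zero_field [of _ n]) (auto intro!: exI [of _ "col Y j"])
  then have "det Q = 0" by simp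
  then obtain v where v: "v \<in> carrier_vec n" "v \<noteq> 0\<^sub>v n" "Q *\<^sub>v v = 0\<^sub>v n"
    using det_0_iff_vec_prod_zero_field [OF Q] by blast
  have "Q *\<^sub>v v = T *\<^sub>v (T *\<^sub>v v) - a \<cdot>\<^sub>v (T *\<^sub>v v) + b \<cdot>\<^sub>v v"
  proof -
    have sm: "(c \<cdot>\<^sub>m M) *\<^sub>v v = c \<cdot>\<^sub>v (M *\<^sub>v v)" if "M \<in> carrier_mat n n" for c and M :: "'a mat"
      using that v by (intro eq_vecI) auto
    show ?thesis
      using T v by (simp add: Q_def add_mult_distrib_mat_vec [of _ n n] minus_mult_distrib_mat_vec [of _ n n]
          minus_carrier_mat sm)
  qed
  then have "T *\<^sub>v (T *\<^sub>v v) - a \<cdot>\<^sub>v (T *\<^sub>v v) + b \<cdot>\<^sub>v v = 0\<^sub>v n" using v by simp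
  moreover have "x = y - z" if "x - y + z = 0\<^sub>v n" "x \<in> carrier_vec n" "y \<in> carrier_vec n" "z \<in> carrier_vec n"
    for x y z :: "'a vec"
    using that by (auto simp: vec_eq_iff algebra_simps eq_neg_iff_add_eq_0)
  ultimately have "T *\<^sub>v (T *\<^sub>v v) = a \<cdot>\<^sub>v (T *\<^sub>v v) - b \<cdot>\<^sub>v v"
    using T v by simp
  then show ?thesis by (rule eigenvector_of_quadratic [OF T sym v(1,2)])
qed

text \<open>The induction is on the exponent of 2 in \<open>n\<close>, not on \<open>n\<close>: for even \<open>n\<close> the second compound has
  size \<open>n (n - 1) / 2\<close>, which is usually larger than \<open>n\<close> but contains one factor 2 less.\<close>

theorem symmetric_eigenvector:
  fixes T :: "'a::real_closed_field mat"
  assumes "T \<in> carrier_mat n n" "transpose_mat T = T" "0 < n"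
  shows "\<exists>\<mu> x. x \<in> carrier_vec n \<and> x \<noteq> 0\<^sub>v n \<and> T *\<^sub>v x = \<mu> \<cdot>\<^sub>v x"
  using assms
proof (induction "multiplicity 2 n" arbitrary: n T rule: less_induct)
  case less
  show ?case
  proof (cases "odd n")
    case True
    have "degree (char_poly T) = n" using degree_monic_char_poly [OF less.prems(1)] by simp
    then obtain \<mu> where "poly (char_poly T) \<mu> = 0" using odd_degree_has_root True by blast
    then have "eigenvalue T \<mu>" using eigenvalue_root_char_poly [OF less.prems(1)] by simp
    then show ?thesis using less.prems(1) by (auto simp: eigenvalue_def eigenvector_def)
  next
    case False
    define m where "m = (\<Sum>l<n. l)"
    have m2: "2 * m = n * (n - 1)"
      unfolding m_def by (induction n) (auto simp: algebra_simps)
    have "n > 1" using False less.prems(3) by (cases "n = 1") auto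
    have "m > 0" using m2 \<open>n > 1\<close> by (cases "m = 0") auto
    have "multiplicity 2 (2 * m) = Suc (multiplicity 2 m)"
      using \<open>m > 0\<close> by (intro multiplicity_times_same) auto
    moreover have "multiplicity 2 (n * (n - 1)) = multiplicity 2 n + multiplicity 2 (n - 1)"
      using \<open>n > 1\<close> by (intro prime_elem_multiplicity_mult_distrib) auto
    moreover have "multiplicity 2 (n - 1) = 0"
      using False \<open>n > 1\<close> by (intro not_dvd_imp_multiplicity_0) auto
    ultimately have "multiplicity 2 m < multiplicity 2 n" using m2 by simp
    from less.hyps [OF this _ _ \<open>m > 0\<close>]
    show ?thesis by (intro symmetric_eigenvector_if_compound [OF less.prems m_def])
  qed
qed

section \<open>Diagonalisability of symmetric and Hermitian matrices\<close>

lemma poly_mat_similar: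
  assumes D: "D \<in> carrier_mat n n" and U: "U \<in> carrier_mat n n" and V: "V \<in> carrier_mat n n"
    and VU: "V * U = 1\<^sub>m n" and UV: "U * V = 1\<^sub>m n"
  shows "poly_mat p (U * D * V) = U * poly_mat p D * V"
proof (induction p)
  case 0
  show ?case using D U V by simp
next
  case (pCons a p)
  note assoc = assoc_mult_mat [of _ n n _ n _ n] mult_carrier_mat [of _ n n _ n]
  have UDV: "U * D * V \<in> carrier_mat n n" using D U V by (simp add: assoc)
  note c = poly_mat_carrier [OF D, of p]
  have mid: "V * (U * M) = M" if "M \<in> carrier_mat n n" for M
    using that VU assoc_mult_mat [OF V U that] by simp
  have "poly_mat (pCons a p) (U * D * V) = a \<cdot>\<^sub>m 1\<^sub>m n + U * poly_mat p D * V * (U * D * V)"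
    by (simp only: poly_mat_pCons [OF UDV] pCons.IH)
  also have "U * poly_mat p D * V * (U * D * V) = U * (poly_mat p D * D) * V"
    using c D U V by (simp add: assoc mid)
  also have "a \<cdot>\<^sub>m 1\<^sub>m n = U * (a \<cdot>\<^sub>m 1\<^sub>m n) * V"
    using U V UV by (simp add: mult_smult_distrib [of _ n n _ n] mult_smult_assoc_mat [of _ n n _ n])
  also have "U * (a \<cdot>\<^sub>m 1\<^sub>m n) * V + U * (poly_mat p D * D) * V = U * (a \<cdot>\<^sub>m 1\<^sub>m n + poly_mat p D * D) * V"
    using c D U V by (simp add: mult_add_distrib_mat [of _ n n _ n] add_mult_distrib_mat [of _ n n _ _ n] assoc)
  finally show ?case by (simp only: poly_mat_pCons [OF D])
qed

lemma poly_mat_block_diag: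
  assumes A: "A \<in> carrier_mat k k" and D: "D \<in> carrier_mat m m"
  shows "poly_mat p (four_block_mat A (0\<^sub>m k m) (0\<^sub>m m k) D) =
    four_block_mat (poly_mat p A) (0\<^sub>m k m) (0\<^sub>m m k) (poly_mat p D)"
proof (induction p)
  case 0
  show ?case using A D by (subst poly_mat_0 [of _ "k + m"]) auto
next
  case (pCons a p)
  let ?B = "four_block_mat A (0\<^sub>m k m) (0\<^sub>m m k) D"
  have B: "?B \<in> carrier_mat (k + m) (k + m)" using A D by simp
  note c = poly_mat_carrier [OF A, of p] poly_mat_carrier [OF D, of p]
  have "poly_mat (pCons a p) ?B = a \<cdot>\<^sub>m 1\<^sub>m (k + m) +
      four_block_mat (poly_mat p A) (0\<^sub>m k m) (0\<^sub>m m k) (poly_mat p D) * ?B"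
    by (simp only: poly_mat_pCons [OF B] pCons.IH)
  also have "four_block_mat (poly_mat p A) (0\<^sub>m k m) (0\<^sub>m m k) (poly_mat p D) * ?B
      = four_block_mat (poly_mat p A * A) (0\<^sub>m k m) (0\<^sub>m m k) (poly_mat p D * D)"
    using A D c by (subst mult_four_block_mat [of _ k k _ m _ m _ _ k _ m]) auto
  also have "a \<cdot>\<^sub>m 1\<^sub>m (k + m) = four_block_mat (a \<cdot>\<^sub>m 1\<^sub>m k) (0\<^sub>m k m) (0\<^sub>m m k) (a \<cdot>\<^sub>m 1\<^sub>m m)"
    by (rule eq_matI) auto
  also have "four_block_mat (a \<cdot>\<^sub>m 1\<^sub>m k) (0\<^sub>m k m) (0\<^sub>m m k) (a \<cdot>\<^sub>m 1\<^sub>m m) +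
      four_block_mat (poly_mat p A * A) (0\<^sub>m k m) (0\<^sub>m m k) (poly_mat p D * D)
      = four_block_mat (a \<cdot>\<^sub>m 1\<^sub>m k + poly_mat p A * A) (0\<^sub>m k m) (0\<^sub>m m k) (a \<cdot>\<^sub>m 1\<^sub>m m + poly_mat p D * D)"
    using A D c by (subst add_four_block_mat [of _ k k _ m _ m]) auto
  finally show ?case by (simp only: poly_mat_pCons [OF A] poly_mat_pCons [OF D])
qed

lemma poly_mat_scalar: "poly_mat p (\<mu> \<cdot>\<^sub>m 1\<^sub>m n) = poly p \<mu> \<cdot>\<^sub>m 1\<^sub>m n"
proof (induction p)
  case 0
  show ?case by (subst poly_mat_0 [of _ n]) auto
next
  case (pCons a p)
  have "poly_mat (pCons a p) (\<mu> \<cdot>\<^sub>m 1\<^sub>m n) = a \<cdot>\<^sub>m 1\<^sub>m n + (poly p \<mu> \<cdot>\<^sub>m 1\<^sub>m n) * (\<mu> \<cdot>\<^sub>m 1\<^sub>m n)"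
    by (subst poly_mat_pCons [of _ n]) (simp_all add: pCons.IH)
  also have "(poly p \<mu> \<cdot>\<^sub>m 1\<^sub>m n) * (\<mu> \<cdot>\<^sub>m 1\<^sub>m n) = poly p \<mu> \<cdot>\<^sub>m (\<mu> \<cdot>\<^sub>m 1\<^sub>m n)"
    by (simp add: mult_smult_assoc_mat [of _ n n _ n])
  also have "a \<cdot>\<^sub>m 1\<^sub>m n + poly p \<mu> \<cdot>\<^sub>m (\<mu> \<cdot>\<^sub>m 1\<^sub>m n) = poly (pCons a p) \<mu> \<cdot>\<^sub>m 1\<^sub>m n"
    by (intro eq_matI) auto
  finally show ?case .
qed

text \<open>The reflection in the hyperplane orthogonal to \<open>w = u - e\<^sub>0\<close> exchanges the unit vectors \<open>e\<^sub>0\<close> and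
  \<open>u\<close>.\<close>

lemma householder_reflection_exists:
  fixes u :: "'a::linordered_field vec"
  assumes u: "u \<in> carrier_vec n" and n: "0 < n" and unit: "u \<bullet> u = 1"
  shows "\<exists>U. U \<in> carrier_mat n n \<and> transpose_mat U = U \<and> U * U = 1\<^sub>m n \<and> U *\<^sub>v unit_vec n 0 = u"
proof (cases "u = unit_vec n 0")
  case True
  then show ?thesis by (intro exI [of _ "1\<^sub>m n"]) auto
next
  case False
  define w where "w = u - unit_vec n 0"
  have w: "w \<in> carrier_vec n" using u by (simp add: w_def)
  have wi: "w $ i = u $ i - (if i = 0 then 1 else 0)" if "i < n" for i
    using that u n by (simp add: w_def)
  have "w \<noteq> 0\<^sub>v n"
  proof
    assume "w = 0\<^sub>v n"
    then have "u $ i = unit_vec n 0 $ i" if "i < n" for i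
      using that wi [OF that] n by simp
    then show False using False u by (auto intro: eq_vecI)
  qed
  define s where "s = w \<bullet> w"
  have s: "s = (\<Sum>k<n. w $ k * w $ k)"
    using w by (simp add: s_def scalar_prod_def atLeast0LessThan)
  have s0: "s \<noteq> 0" using scalar_prod_self_eq_0_iff [OF w] \<open>w \<noteq> 0\<^sub>v n\<close> by (simp add: s_def)
  have "s = u \<bullet> u - u $ 0 - (u $ 0 - 1)"
    using u n by (simp add: s_def w_def scalar_prod_minus_distrib [of _ n] minus_scalar_prod_distrib [of _ n])
  \<comment> \<open>The key relation: it turns the coefficient \<open>2 w\<^sub>0 / s\<close> of \<open>w\<close> in \<open>e\<^sub>0 - U e\<^sub>0\<close> into \<open>-1\<close>.\<close>
  then have sw: "s = - 2 * w $ 0" using wi [OF n] unit by simp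
  define U where "U = mat n n (\<lambda>(i, j). (if i = j then 1 else 0) - 2 / s * (w $ i * w $ j))"
  have U: "U \<in> carrier_mat n n" by (simp add: U_def)
  have "transpose_mat U = U" by (auto simp: U_def intro!: eq_matI)
  moreover have "U * U = 1\<^sub>m n"
  proof (rule eq_matI)
    fix i j assume "i < dim_row (1\<^sub>m n :: 'a mat)" "j < dim_col (1\<^sub>m n :: 'a mat)"
    then have ij: "i < n" "j < n" by auto
    have "(U * U) $$ (i, j) = (\<Sum>k<n. U $$ (i, k) * U $$ (k, j))"
      using ij U by (simp add: scalar_prod_def atLeast0LessThan)
    also have "\<dots> = (\<Sum>k<n. (if k = i then (if k = j then 1 else 0) - 2 / s * (w $ k * w $ j) else 0)
        - (if k = j then 2 / s * (w $ i * w $ k) else 0)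
        + 2 / s * (2 / s) * (w $ i * w $ j) * (w $ k * w $ k))"
      using ij by (intro sum.cong refl) (auto simp: U_def algebra_simps)
    also have "\<dots> = (if i = j then 1 else 0) - 2 / s * (w $ i * w $ j) - 2 / s * (w $ i * w $ j)
        + 2 / s * (2 / s) * (w $ i * w $ j) * s"
      using ij by (simp only: sum.distrib sum_subtractf sum_distrib_left [symmetric] s [symmetric])
        (simp add: sum.delta)
    also have "\<dots> = 1\<^sub>m n $$ (i, j)" using ij s0 by (simp add: field_simps)
    finally show "(U * U) $$ (i, j) = 1\<^sub>m n $$ (i, j)" .
  qed (use U in auto)
  moreover have "U *\<^sub>v unit_vec n 0 = u"
  proof (rule eq_vecI)
    fix i assume "i < dim_vec u"
    then have i: "i < n" using u by simp
    have "(U *\<^sub>v unit_vec n 0) $ i = U $$ (i, 0)"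
      using i U n by simp
    also have "\<dots> = (if i = 0 then 1 else 0) - 2 / s * (w $ i * w $ 0)" using i n by (simp add: U_def)
    also have "\<dots> = (if i = 0 then 1 else 0) + w $ i"
      using s0 unfolding sw by (simp add: field_simps)
    also have "\<dots> = u $ i" using wi [OF i] by simp
    finally show "(U *\<^sub>v unit_vec n 0) $ i = u $ i" .
  qed (use u U in auto)
  ultimately show ?thesis using U by blast
qed

text \<open>A reflection that moves the first basis vector to an eigenvector makes the first column, and by
  symmetry also the first row, of the transformed matrix vanish off the diagonal. Reflections keep the
  remaining block symmetric, so the step can be repeated.\<close>

lemma symmetric_deflation:
  fixes T :: "'a::real_closed_field mat"
  assumes T: "T \<in> carrier_mat (Suc m) (Suc m)" and sym: "transpose_mat T = T"
  shows "\<exists>U \<mu> D. U \<in> carrier_mat (Suc m) (Suc m) \<and> U * U = 1\<^sub>m (Suc m) \<and>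
    D \<in> carrier_mat m m \<and> transpose_mat D = D \<and>
    T = U * four_block_mat (\<mu> \<cdot>\<^sub>m 1\<^sub>m 1) (0\<^sub>m 1 m) (0\<^sub>m m 1) D * U"
proof -
  let ?n = "Suc m"
  obtain \<mu> x where x: "x \<in> carrier_vec ?n" "x \<noteq> 0\<^sub>v ?n" "T *\<^sub>v x = \<mu> \<cdot>\<^sub>v x"
    using symmetric_eigenvector [OF T sym] by blast
  have "0 < x \<bullet> x"
    using scalar_prod_self_nonneg [of x] scalar_prod_self_eq_0_iff [OF x(1)] x(2) by (simp add: less_le)
  then obtain r where r: "r * r = x \<bullet> x" "r \<noteq> 0" using nonneg_is_square [of "x \<bullet> x"] by force
  define u where "u = (1 / r) \<cdot>\<^sub>v x"
  have u: "u \<in> carrier_vec ?n" using x by (simp add: u_def)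
  have uu: "u \<bullet> u = 1" using x(1) r by (simp add: u_def r(1) [symmetric])
  have Tu: "T *\<^sub>v u = \<mu> \<cdot>\<^sub>v u"
    using T x by (simp add: u_def mult_mat_vec [of _ ?n ?n] smult_smult_assoc mult.commute)
  obtain U where U: "U \<in> carrier_mat ?n ?n" "transpose_mat U = U" "U * U = 1\<^sub>m ?n"
    and Ue: "U *\<^sub>v unit_vec ?n 0 = u"
    using householder_reflection_exists [OF u _ uu] by auto
  note assoc = assoc_mult_mat [of _ ?n ?n _ ?n _ ?n] mult_carrier_mat [of _ ?n ?n _ ?n]
  define D where "D = U * T * U"
  have D: "D \<in> carrier_mat ?n ?n" using U T by (simp add: D_def assoc)
  have DT: "transpose_mat D = D"
    using U T sym by (simp add: D_def transpose_mult [of _ ?n ?n _ ?n] assoc)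
  have symD: "D $$ (i, j) = D $$ (j, i)" if "i < ?n" "j < ?n" for i j
    using that D arg_cong [OF DT, of "\<lambda>M. M $$ (i, j)"] by simp
  have "D *\<^sub>v unit_vec ?n 0 = U *\<^sub>v (T *\<^sub>v u)"
    using U T by (simp add: D_def Ue [symmetric] assoc_mult_mat_vec [of _ ?n ?n _ ?n] assoc)
  also have "\<dots> = \<mu> \<cdot>\<^sub>v (U *\<^sub>v u)" using U u by (simp add: Tu mult_mat_vec [of _ ?n ?n])
  also have "U *\<^sub>v u = (U * U) *\<^sub>v unit_vec ?n 0"
    by (subst assoc_mult_mat_vec [OF U(1) U(1)]) (simp_all add: Ue)
  also have "\<dots> = unit_vec ?n 0" by (simp add: U)
  finally have De: "D *\<^sub>v unit_vec ?n 0 = \<mu> \<cdot>\<^sub>v unit_vec ?n 0" .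
  have D0: "D $$ (i, 0) = (if i = 0 then \<mu> else 0)" if "i < ?n" for i
  proof -
    have "D $$ (i, 0) = (D *\<^sub>v unit_vec ?n 0) $ i" using that D by simp
    then show ?thesis using that by (simp add: De)
  qed
  define D' where "D' = mat m m (\<lambda>(i, j). D $$ (Suc i, Suc j))"
  have D': "D' \<in> carrier_mat m m" by (simp add: D'_def)
  have "transpose_mat D' = D'" using symD by (auto simp: D'_def intro!: eq_matI)
  moreover have "D = four_block_mat (\<mu> \<cdot>\<^sub>m 1\<^sub>m 1) (0\<^sub>m 1 m) (0\<^sub>m m 1) D'"
    using D D' D0 symD [of 0] by (intro eq_matI) (auto simp: D'_def)
  moreover have "T = U * D * U"
  proof -
    have "U * D * U = (U * U) * T * (U * U)" using U(1) T by (simp add: D_def assoc)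
    then show ?thesis using T by (simp add: U)
  qed
  ultimately show ?thesis using U D' by blast
qed

text \<open>Distinctness costs nothing: if the eigenvalue that is split off already occurs among the
  eigenvalues of the smaller block, the product for that block annihilates both parts.\<close>

theorem symmetric_annihilated_by_distinct_linear_factors:
  fixes T :: "'a::real_closed_field mat"
  assumes "T \<in> carrier_mat n n" "transpose_mat T = T"
  shows "\<exists>\<Lambda>. finite \<Lambda> \<and> poly_mat (\<Prod>c\<in>\<Lambda>. [:- c, 1:]) T = 0\<^sub>m n n"
  using assms
proof (induction n arbitrary: T)
  case 0
  then show ?case by (intro exI [of _ "{}"]) auto
next
  case (Suc m)
  obtain U \<mu> D where U: "U \<in> carrier_mat (Suc m) (Suc m)" "U * U = 1\<^sub>m (Suc m)"
    and D: "D \<in> carrier_mat m m" "transpose_mat D = D"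
    and TU: "T = U * four_block_mat (\<mu> \<cdot>\<^sub>m 1\<^sub>m 1) (0\<^sub>m 1 m) (0\<^sub>m m 1) D * U"
    using symmetric_deflation [OF Suc.prems] by blast
  obtain \<Lambda> where fin: "finite \<Lambda>" and ann: "poly_mat (\<Prod>c\<in>\<Lambda>. [:- c, 1:]) D = 0\<^sub>m m m"
    using Suc.IH [OF D] by blast
  define p where "p = (\<Prod>c\<in>insert \<mu> \<Lambda>. [:- c, 1:])"
  have "poly p \<mu> = 0" using fin by (simp add: p_def poly_prod)
  moreover have "poly_mat p D = 0\<^sub>m m m"
  proof (cases "\<mu> \<in> \<Lambda>")
    case True
    then show ?thesis using ann by (simp add: p_def insert_absorb)
  next
    case False
    then have "p = [:- \<mu>, 1:] * (\<Prod>c\<in>\<Lambda>. [:- c, 1:])" using fin by (simp add: p_def)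
    then have "poly_mat p D = poly_mat [:- \<mu>, 1:] D * 0\<^sub>m m m"
      by (simp only: poly_mat_mult [OF D(1)] ann)
    then show ?thesis using D by simp
  qed
  ultimately have "poly_mat p (four_block_mat (\<mu> \<cdot>\<^sub>m 1\<^sub>m 1) (0\<^sub>m 1 m) (0\<^sub>m m 1) D) = 0\<^sub>m (Suc m) (Suc m)"
    using D by (subst poly_mat_block_diag [of _ 1 _ m]) (auto simp: poly_mat_scalar intro!: eq_matI)
  moreover have "four_block_mat (\<mu> \<cdot>\<^sub>m 1\<^sub>m 1) (0\<^sub>m 1 m) (0\<^sub>m m 1) D \<in> carrier_mat (Suc m) (Suc m)"
    using D by (auto intro: carrier_matI)
  ultimately have "poly_mat p T = 0\<^sub>m (Suc m) (Suc m)"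
    unfolding TU using U by (subst poly_mat_similar [of _ "Suc m"]) auto
  then show ?case using fin by (intro exI [of _ "insert \<mu> \<Lambda>"]) (simp add: p_def)
qed

text \<open>The matrix, in the basis \<open>e\<^sub>1, \<dots>, e\<^sub>n, i e\<^sub>1, \<dots>, i e\<^sub>n\<close>, of \<open>H\<close> regarded as a linear map over the
  base field. It is a ring homomorphism that turns Hermitian matrices into symmetric ones.\<close>

definition realify :: "'a::linordered_field gext mat \<Rightarrow> 'a mat" where
  "realify H = four_block_mat (map_mat re_part H) (- map_mat im_part H) (map_mat im_part H) (map_mat re_part H)"

lemma realify_carrier [simp]: "H \<in> carrier_mat n n \<Longrightarrow> realify H \<in> carrier_mat (n + n) (n + n)"
  by (simp add: realify_def)

lemma gext_part_sum:
  fixes f :: "'b \<Rightarrow> 'a::linordered_field gext"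
  shows "re_part (sum f A) = (\<Sum>x\<in>A. re_part (f x))" "im_part (sum f A) = (\<Sum>x\<in>A. im_part (f x))"
  by (induction A rule: infinite_finite_induct) (simp_all add: zero_gext_def plus_gext_def)

lemma realify_mult:
  assumes "H \<in> carrier_mat n n" "G \<in> carrier_mat n n"
  shows "realify (H * G) = realify H * realify G"
proof -
  let ?R = "map_mat re_part" and ?I = "map_mat im_part"
  have R: "?R (H * G) = ?R H * ?R G + (- ?I H) * ?I G"
    using assms by (intro eq_matI)
      (auto simp: scalar_prod_def gext_part_sum times_gext_def sum_subtractf sum_negf)
  have I: "?I (H * G) = ?I H * ?R G + ?R H * ?I G"
    using assms by (intro eq_matI)
      (auto simp: scalar_prod_def gext_part_sum times_gext_def sum.distrib)
  have I': "- ?I (H * G) = ?R H * (- ?I G) + (- ?I H) * ?R G"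
    unfolding I using assms by (intro eq_matI) auto
  have R': "?R (H * G) = ?I H * (- ?I G) + ?R H * ?R G"
    unfolding R using assms by (intro eq_matI) auto
  show ?thesis
    unfolding realify_def using assms
    by (subst mult_four_block_mat [of _ n n _ n _ n _ _ n _ n])
      (simp_all only: map_carrier_mat uminus_carrier_iff_mat cong_four_block_mat [OF R I' I R'])
qed

lemma realify_add:
  assumes "H \<in> carrier_mat n n" "G \<in> carrier_mat n n"
  shows "realify (H + G) = realify H + realify G"
  using assms by (intro eq_matI) (auto simp: realify_def plus_gext_def)

lemma realify_scalar:
  "realify (of_base c \<cdot>\<^sub>m 1\<^sub>m n) = c \<cdot>\<^sub>m 1\<^sub>m (n + n)"
  by (intro eq_matI) (auto simp: realify_def of_base_def times_gext_def one_gext_def zero_gext_def)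

lemma of_base_hom: "inj_comm_ring_hom (of_base :: 'a::linordered_field \<Rightarrow> 'a gext)"
  by unfold_locales (auto simp: of_base_def gext_defs)

lemma realify_poly_mat:
  fixes H :: "'a::linordered_field gext mat"
  assumes H: "H \<in> carrier_mat n n"
  shows "realify (poly_mat (map_poly of_base p) H) = poly_mat p (realify H)"
proof (induction p)
  case 0
  show ?case
    using H by (subst poly_mat_0 [OF realify_carrier [OF H]])
      (auto simp: realify_def zero_gext_def intro!: eq_matI)
next
  case (pCons a p)
  interpret inj_comm_ring_hom "of_base :: 'a \<Rightarrow> 'a gext" by (rule of_base_hom)
  have c: "poly_mat (map_poly of_base p) H \<in> carrier_mat n n" using H by simp
  have "poly_mat (map_poly of_base (pCons a p)) H = of_base a \<cdot>\<^sub>m 1\<^sub>m n + poly_mat (map_poly of_base p) H * H"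
    by (simp only: Polynomial.map_poly_pCons [where f = of_base, OF of_base_simps(1)] poly_mat_pCons [OF H])
  then have "realify (poly_mat (map_poly of_base (pCons a p)) H)
      = a \<cdot>\<^sub>m 1\<^sub>m (n + n) + poly_mat p (realify H) * realify H"
    using H c by (simp add: realify_add [of _ n] realify_mult [of _ n] realify_scalar pCons.IH mult_carrier_mat [OF c H])
  then show ?case by (simp only: poly_mat_pCons [OF realify_carrier [OF H]])
qed

lemma realify_eq_0:
  assumes H: "H \<in> carrier_mat n n" and "realify H = 0\<^sub>m (n + n) (n + n)"
  shows "H = 0\<^sub>m n n"
proof (rule eq_matI)
  fix i j assume "i < dim_row (0\<^sub>m n n :: 'a gext mat)" "j < dim_col (0\<^sub>m n n :: 'a gext mat)"
  then have ij: "i < n" "j < n" by auto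
  have "realify H $$ (i, j) = 0" "realify H $$ (i + n, j) = 0" using assms ij by auto
  then show "H $$ (i, j) = 0\<^sub>m n n $$ (i, j)"
    using ij H by (simp add: realify_def gext_eq_iff zero_gext_def)
qed (use H in auto)

theorem hermitian_annihilated_by_distinct_linear_factors:
  fixes H :: "'a::real_closed_field gext mat"
  assumes H: "H \<in> carrier_mat n n" and herm: "mat_adjoint H = H"
  shows "\<exists>\<Lambda>. finite \<Lambda> \<and> poly_mat (map_poly of_base (\<Prod>c\<in>\<Lambda>. [:- c, 1:])) H = 0\<^sub>m n n"
proof -
  have ad: "H $$ (i, j) = conjugate (H $$ (j, i))" if "i < n" "j < n" for i j
    using mat_adjoint_index [of i H j] that H herm by simp
  have "re_part (H $$ (j, i)) = re_part (H $$ (i, j))" "- im_part (H $$ (j, i)) = im_part (H $$ (i, j))"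
    if "i < n" "j < n" for i j
    by (simp_all add: ad [OF that] conjugate_gext_def)
  then have R: "transpose_mat (map_mat re_part H) = map_mat re_part H"
    and I: "transpose_mat (- map_mat im_part H) = map_mat im_part H"
    using H by (simp_all add: mat_eq_iff)
  have "transpose_mat (map_mat im_part H) = - map_mat im_part H"
    by (subst I [symmetric]) simp
  then have "transpose_mat (realify H) = realify H"
    using H by (simp add: realify_def transpose_four_block_mat [of _ n n _ n _ n] R I)
  then obtain \<Lambda> where "finite \<Lambda>" "poly_mat (\<Prod>c\<in>\<Lambda>. [:- c, 1:]) (realify H) = 0\<^sub>m (n + n) (n + n)"
    using symmetric_annihilated_by_distinct_linear_factors [of "realify H" "n + n"] H by auto
  then have "poly_mat (map_poly of_base (\<Prod>c\<in>\<Lambda>. [:- c, 1:])) H = 0\<^sub>m n n"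
    using realify_poly_mat [OF H] realify_eq_0 [OF poly_mat_carrier [OF H]] by metis
  then show ?thesis using \<open>finite \<Lambda>\<close> by blast
qed

section \<open>Spectral projections\<close>

lemma poly_mat_eigen:
  assumes T: "T \<in> carrier_mat n n" and Y: "Y \<in> carrier_mat n n" and TY: "T * Y = d \<cdot>\<^sub>m Y"
  shows "poly_mat p T * Y = poly p d \<cdot>\<^sub>m Y"
proof (induction p)
  case 0
  show ?case using T Y by (intro eq_matI) auto
next
  case (pCons a p)
  note c = poly_mat_carrier [OF T, of p]
  have "poly_mat (pCons a p) T * Y = (a \<cdot>\<^sub>m 1\<^sub>m n) * Y + poly_mat p T * T * Y"
    unfolding poly_mat_pCons [OF T] using c T Y
    by (intro add_mult_distrib_mat [of _ n n _ _ n] mult_carrier_mat [OF c T]) auto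
  also have "poly_mat p T * T * Y = d \<cdot>\<^sub>m (poly p d \<cdot>\<^sub>m Y)"
    using c Y by (simp add: assoc_mult_mat [OF c T Y] TY mult_smult_distrib [OF c Y] pCons.IH)
  also have "(a \<cdot>\<^sub>m 1\<^sub>m n) * Y = a \<cdot>\<^sub>m Y"
    using Y by (simp add: mult_smult_assoc_mat [of _ n n _ n])
  also have "a \<cdot>\<^sub>m Y + d \<cdot>\<^sub>m (poly p d \<cdot>\<^sub>m Y) = poly (pCons a p) d \<cdot>\<^sub>m Y"
    by (intro eq_matI) (auto simp: algebra_simps)
  finally show ?case .
qed

lemma poly_mat_sum_index:
  assumes T: "T \<in> carrier_mat n n" and "i < n" "j < n"
  shows "poly_mat (sum p I) T $$ (i, j) = (\<Sum>x\<in>I. poly_mat (p x) T $$ (i, j))"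
proof (induction I rule: infinite_finite_induct)
  case (insert x I)
  then show ?case using assms by (simp add: poly_mat_add [OF T])
qed (use assms in simp_all)

lemma finsum_mat_index:
  fixes M :: "'i \<Rightarrow> 'b::comm_ring_1 mat"
  assumes "finite I" "\<And>x. x \<in> I \<Longrightarrow> M x \<in> carrier_mat n n" "i < n" "j < n"
  shows "(\<Oplus>\<^bsub>ring_mat TYPE('b) n ()\<^esub> x\<in>I. M x) $$ (i, j) = (\<Sum>x\<in>I. M x $$ (i, j))"
    and "(\<Oplus>\<^bsub>ring_mat TYPE('b) n ()\<^esub> x\<in>I. M x) \<in> carrier_mat n n"
proof -
  interpret R: ring "ring_mat TYPE('b) n ()" by (rule ring_mat)
  have closed: "(\<Oplus>\<^bsub>ring_mat TYPE('b) n ()\<^esub> x\<in>J. M x) \<in> carrier_mat n n" if "J \<subseteq> I" for J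
    using R.finsum_closed [of M J] that assms(2) by (auto simp: ring_mat_simps)
  then show "(\<Oplus>\<^bsub>ring_mat TYPE('b) n ()\<^esub> x\<in>I. M x) \<in> carrier_mat n n" by simp
  show "(\<Oplus>\<^bsub>ring_mat TYPE('b) n ()\<^esub> x\<in>I. M x) $$ (i, j) = (\<Sum>x\<in>I. M x $$ (i, j))"
    using assms(1) subset_refl [of I]
  proof (induction rule: finite_subset_induct')
    case empty
    then show ?case using assms by (simp add: ring_mat_simps)
  next
    case (insert x F)
    have "(\<Oplus>\<^bsub>ring_mat TYPE('b) n ()\<^esub> x\<in>insert x F. M x)
        = M x + (\<Oplus>\<^bsub>ring_mat TYPE('b) n ()\<^esub> x\<in>F. M x)"
      using insert.hyps assms(2) insert.hyps(3) by (subst R.finsum_insert) (auto simp: ring_mat_simps)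
    then show ?case
      using insert.hyps insert.IH assms closed [OF insert.hyps(3)] by simp
  qed
qed

definition lagrange :: "'a::field set \<Rightarrow> 'a \<Rightarrow> 'a poly" where
  "lagrange \<Lambda> x = (\<Prod>y\<in>\<Lambda> - {x}. Polynomial.smult (1 / (x - y)) [:- y, 1:])"

lemma poly_lagrange:
  assumes "finite \<Lambda>" "x \<in> \<Lambda>" "z \<in> \<Lambda>"
  shows "poly (lagrange \<Lambda> x) z = (if z = x then 1 else 0)"
proof -
  have "poly (lagrange \<Lambda> x) z = (\<Prod>y\<in>\<Lambda> - {x}. (z - y) / (x - y))"
    unfolding lagrange_def poly_prod by (intro prod.cong refl) (simp add: diff_divide_distrib)
  also have "\<dots> = (if z = x then 1 else 0)"
    using assms by (auto intro!: prod.neutral prod_zero)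
  finally show ?thesis .
qed

lemma sum_lagrange:
  assumes "finite \<Lambda>" "\<Lambda> \<noteq> {}"
  shows "(\<Sum>x\<in>\<Lambda>. lagrange \<Lambda> x) = 1"
proof (rule poly_eqI_degree [where A = \<Lambda>])
  show "poly (\<Sum>x\<in>\<Lambda>. lagrange \<Lambda> x) z = poly 1 z" if "z \<in> \<Lambda>" for z
    using assms that by (simp add: poly_sum poly_lagrange)
  have pos: "0 < card \<Lambda>" using assms by (simp add: card_gt_0_iff)
  have "degree (lagrange \<Lambda> x) \<le> card \<Lambda> - 1" if "x \<in> \<Lambda>" for x
  proof -
    have "degree (lagrange \<Lambda> x) \<le> (\<Sum>y\<in>\<Lambda> - {x}. degree (Polynomial.smult (1 / (x - y)) [:- y, 1:]))"
      unfolding lagrange_def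
      using degree_prod_sum_le [of "\<Lambda> - {x}" "\<lambda>y. Polynomial.smult (1 / (x - y)) [:- y, 1:]"] assms
      by (simp only: o_def finite_Diff)
    also have "\<dots> \<le> (\<Sum>y\<in>\<Lambda> - {x}. 1)"
      by (intro sum_mono) (auto intro: order_trans [OF degree_smult_le])
    also have "\<dots> = card \<Lambda> - 1" using assms that by simp
    finally show ?thesis .
  qed
  then have "degree (\<Sum>x\<in>\<Lambda>. lagrange \<Lambda> x) \<le> card \<Lambda> - 1"
    using assms by (intro degree_sum_le) auto
  then show "degree (\<Sum>x\<in>\<Lambda>. lagrange \<Lambda> x) < card \<Lambda>" using pos by simp
  show "degree (1 :: 'a poly) < card \<Lambda>" using pos by simp
qed

lemma lagrange_times_linear:
  assumes "finite \<Lambda>" "x \<in> \<Lambda>"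
  shows "\<exists>c. [:- x, 1:] * lagrange \<Lambda> x = Polynomial.smult c (\<Prod>y\<in>\<Lambda>. [:- y, 1:])"
proof -
  have "lagrange \<Lambda> x = Polynomial.smult (\<Prod>y\<in>\<Lambda> - {x}. 1 / (x - y)) (\<Prod>y\<in>\<Lambda> - {x}. [:- y, 1:])"
    unfolding lagrange_def by (rule prod_smult)
  moreover have "(\<Prod>y\<in>\<Lambda>. [:- y, 1:]) = [:- x, 1:] * (\<Prod>y\<in>\<Lambda> - {x}. [:- y, 1:])"
    using assms by (rule prod.remove)
  ultimately show ?thesis by (metis mult_smult_right)
qed

lemma conjugate_hom: "comm_ring_hom (conjugate :: 'a::linordered_field gext \<Rightarrow> 'a gext)"
  by unfold_locales (auto simp: conjugate_gext_def gext_defs)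

lemma adjoint_carrier [simp]:
  "A \<in> carrier_mat nr nc \<Longrightarrow> mat_adjoint (A :: 'a::linordered_field gext mat) \<in> carrier_mat nc nr"
  by (auto simp: mat_adjoint_def)

lemma adjoint_eq: "mat_adjoint A = map_mat conjugate (transpose_mat A)"
  for A :: "'a::linordered_field gext mat"
  by (rule eq_matI) (auto simp: mat_adjoint_index, auto simp: mat_adjoint_def)

lemma adjoint_mult:
  fixes A B :: "'a::linordered_field gext mat"
  assumes "A \<in> carrier_mat n n" "B \<in> carrier_mat n n"
  shows "mat_adjoint (A * B) = mat_adjoint B * mat_adjoint A"
proof -
  interpret comm_ring_hom "conjugate :: 'a gext \<Rightarrow> 'a gext" by (rule conjugate_hom)
  show ?thesis using assms by (simp add: adjoint_eq transpose_mult [of _ n n _ n] mat_hom_mult [of _ n n _ n])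
qed

lemma adjoint_adjoint: "mat_adjoint (mat_adjoint A) = A" for A :: "'a::linordered_field gext mat"
  by (rule eq_matI) (auto simp: adjoint_eq)

lemma adjoint_smult_of_base:
  "mat_adjoint (of_base c \<cdot>\<^sub>m A) = of_base c \<cdot>\<^sub>m mat_adjoint A"
  for A :: "'a::linordered_field gext mat"
  by (rule eq_matI) (auto simp: adjoint_eq conjugate_gext_def of_base_def gext_defs)

text \<open>Coefficients in the base field are fixed by conjugation, and the adjoint only reverses the order
  of products of powers of one matrix.\<close>

lemma adjoint_poly_mat:
  fixes H :: "'a::linordered_field gext mat"
  assumes H: "H \<in> carrier_mat n n" and herm: "mat_adjoint H = H"
  shows "mat_adjoint (poly_mat (map_poly of_base p) H) = poly_mat (map_poly of_base p) H"
proof (induction p)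
  case 0
  show ?case using H by (auto simp: adjoint_eq intro!: eq_matI)
next
  case (pCons a p)
  let ?P = "poly_mat (map_poly of_base p) H"
  have c: "?P \<in> carrier_mat n n" using H by simp
  have P: "poly_mat (map_poly of_base (pCons a p)) H = of_base a \<cdot>\<^sub>m 1\<^sub>m n + ?P * H"
    by (simp only: Polynomial.map_poly_pCons [where f = of_base, OF of_base_simps(1)] poly_mat_pCons [OF H])
  have "poly_mat [:0, 1:] H = H" using H by (simp add: poly_mat_linear [OF H]) (auto intro!: eq_matI)
  then have comm: "?P * H = H * ?P"
    using poly_mat_commute [OF H] by metis
  have add: "mat_adjoint (M + N) = mat_adjoint M + mat_adjoint N" if "M \<in> carrier_mat n n" "N \<in> carrier_mat n n"
    for M N :: "'a gext mat"
    using that by (intro eq_matI) (auto simp: adjoint_eq conjugate_dist_add)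
  have one: "mat_adjoint (1\<^sub>m n :: 'a gext mat) = 1\<^sub>m n"
    by (intro eq_matI) (auto simp: adjoint_eq conjugate_gext_def gext_defs)
  have "mat_adjoint (of_base a \<cdot>\<^sub>m 1\<^sub>m n + ?P * H) = of_base a \<cdot>\<^sub>m 1\<^sub>m n + H * ?P"
    using c H by (subst add)
      (simp_all add: adjoint_smult_of_base one adjoint_mult [OF c H] pCons.IH herm mult_carrier_mat [OF c H])
  then show ?case by (simp only: P comm)
qed

text \<open>The diagonal entries of \<open>M\<^sup>*M\<close> are sums of squares, one for each column of \<open>M\<close>. This is the only
  form of positivity needed to compare \<open>A P\<^sub>\<lambda>\<close> with \<open>P\<^sub>\<lambda>\<close>.\<close>

lemma adjoint_mult_self_diag:
  fixes M :: "'a::linordered_field gext mat"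
  assumes "M \<in> carrier_mat n n" "j < n"
  shows "re_part ((mat_adjoint M * M) $$ (j, j)) =
    (\<Sum>k<n. re_part (M $$ (k, j)) * re_part (M $$ (k, j)) + im_part (M $$ (k, j)) * im_part (M $$ (k, j)))"
  using assms
  by (simp add: adjoint_eq scalar_prod_def gext_part_sum conjugate_gext_def times_gext_def atLeast0LessThan)

lemma gram_diag_nonneg:
  fixes M :: "'a::linordered_field gext mat"
  assumes "M \<in> carrier_mat n n" "j < n"
  shows "0 \<le> re_part ((mat_adjoint M * M) $$ (j, j))"
  unfolding adjoint_mult_self_diag [OF assms] by (intro sum_nonneg) simp

lemma gram_diag_pos:
  fixes M :: "'a::linordered_field gext mat"
  assumes M: "M \<in> carrier_mat n n" and ij: "i < n" "j < n" "M $$ (i, j) \<noteq> 0"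
  shows "0 < re_part ((mat_adjoint M * M) $$ (j, j))"
  unfolding adjoint_mult_self_diag [OF M ij(2)]
proof (rule sum_pos2 [of _ i])
  show "0 < re_part (M $$ (i, j)) * re_part (M $$ (i, j)) + im_part (M $$ (i, j)) * im_part (M $$ (i, j))"
    using ij by (simp add: sum_squares_gt_zero_iff gext_eq_iff zero_gext_def)
qed (use ij in auto)

section \<open>The singular value decomposition\<close>

lemma base_matsE:
  assumes "A \<in> base_mats n"
  obtains M where "M \<in> carrier_mat n n" "A = map_mat of_base M"
  using assms by (auto simp: base_mats_def)

text \<open>The matrices of the decomposition have this shape, which is why a real \<open>A\<close> has real ones.\<close>

lemma base_mats_gram_poly:
  fixes A :: "'a::linordered_field gext mat"
  assumes "A \<in> base_mats n"
  shows "of_base c \<cdot>\<^sub>m (A * poly_mat (map_poly of_base p) (mat_adjoint A * A)) \<in> base_mats n"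
proof -
  interpret inj_comm_ring_hom "of_base :: 'a \<Rightarrow> 'a gext" by (rule of_base_hom)
  obtain M where M: "M \<in> carrier_mat n n" and A: "A = map_mat of_base M" using assms by (rule base_matsE)
  have "mat_adjoint A = map_mat of_base (transpose_mat M)"
    by (auto simp: A adjoint_eq conjugate_gext_def of_base_def intro!: eq_matI)
  then have "mat_adjoint A * A = map_mat of_base (transpose_mat M * M)"
    using M by (simp add: A mat_hom_mult [of _ n n _ n])
  then have "poly_mat (map_poly of_base p) (mat_adjoint A * A) = map_mat of_base (poly_mat p (transpose_mat M * M))"
    using poly_mat_hom [OF comm_ring_hom_axioms, of "transpose_mat M * M" n p] M by simp
  then have "A * poly_mat (map_poly of_base p) (mat_adjoint A * A) = map_mat of_base (M * poly_mat p (transpose_mat M * M))"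
    using M by (simp add: A mat_hom_mult [of _ n n _ n])
  then have "of_base c \<cdot>\<^sub>m (A * poly_mat (map_poly of_base p) (mat_adjoint A * A))
      = map_mat of_base (c \<cdot>\<^sub>m (M * poly_mat p (transpose_mat M * M)))"
    by (auto simp: of_base_simps intro!: eq_matI simp del: index_mult_mat(1))
  then show ?thesis using M by (auto simp: base_mats_def)
qed

text \<open>\<open>H\<close> acts on the range of each \<open>P y\<close> as the scalar \<open>y\<close>, so a polynomial in \<open>H\<close> acts there as its
  value at \<open>y\<close>. Hence the product \<open>P x * P y\<close> reflects the values of the Lagrange polynomials, and
  \<open>[:- x, 1:] * lagrange \<Lambda> x\<close>, a multiple of the annihilating polynomial, gives the eigenvalue
  relation.\<close>

lemma hermitian_spectral_projections:
  fixes H :: "'a::real_closed_field gext mat"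
  assumes H: "H \<in> carrier_mat n n" and herm: "mat_adjoint H = H" and n: "0 < n"
  shows "\<exists>\<Lambda> L. finite \<Lambda> \<and> (\<Sum>x\<in>\<Lambda>. L x) = 1 \<and>
    (\<forall>x\<in>\<Lambda>. H * poly_mat (map_poly of_base (L x)) H = of_base x \<cdot>\<^sub>m poly_mat (map_poly of_base (L x)) H) \<and>
    (\<forall>x\<in>\<Lambda>. \<forall>y\<in>\<Lambda>. poly_mat (map_poly of_base (L x)) H * poly_mat (map_poly of_base (L y)) H =
      (if x = y then poly_mat (map_poly of_base (L y)) H else 0\<^sub>m n n))"
proof -
  interpret ob: inj_comm_ring_hom "of_base :: 'a \<Rightarrow> 'a gext" by (rule of_base_hom)
  interpret map_poly_comm_ring_hom "of_base :: 'a \<Rightarrow> 'a gext" ..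
  obtain \<Lambda> where fin: "finite \<Lambda>"
    and ann: "poly_mat (map_poly of_base (\<Prod>c\<in>\<Lambda>. [:- c, 1:])) H = 0\<^sub>m n n"
    using hermitian_annihilated_by_distinct_linear_factors [OF H herm] by blast
  have "\<Lambda> \<noteq> {}"
  proof
    assume "\<Lambda> = {}"
    then have "1\<^sub>m n = (0\<^sub>m n n :: 'a gext mat)" using ann H by simp
    then have "1\<^sub>m n $$ (0, 0) = (0\<^sub>m n n :: 'a gext mat) $$ (0, 0)" by simp
    then show False using n by simp
  qed
  define P where "P = (\<lambda>x. poly_mat (map_poly of_base (lagrange \<Lambda> x)) H)"
  have P: "P x \<in> carrier_mat n n" for x using H by (simp add: P_def)
  have HP: "H * P x = of_base x \<cdot>\<^sub>m P x" if x: "x \<in> \<Lambda>" for x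
  proof -
    obtain c where c: "[:- x, 1:] * lagrange \<Lambda> x = Polynomial.smult c (\<Prod>y\<in>\<Lambda>. [:- y, 1:])"
      using lagrange_times_linear [OF fin x] by blast
    have "poly_mat (map_poly of_base [:- x, 1:]) H * P x = poly_mat (map_poly of_base ([:- x, 1:] * lagrange \<Lambda> x)) H"
      by (simp only: P_def hom_mult poly_mat_mult [OF H])
    also have "\<dots> = poly_mat (map_poly of_base [:c:]) H * 0\<^sub>m n n"
      by (simp only: c ann [symmetric] poly_mat_mult [OF H, symmetric] hom_mult [symmetric]) simp
    also have "\<dots> = 0\<^sub>m n n" using H by simp
    also have "map_poly of_base [:- x, 1:] = [:- of_base x, 1:]"
      by (simp add: ob.map_poly_pCons_hom ob.hom_uminus)
    finally have "(- of_base x \<cdot>\<^sub>m 1\<^sub>m n + H) * P x = 0\<^sub>m n n"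
      by (simp add: poly_mat_linear [OF H])
    then have *: "- of_base x \<cdot>\<^sub>m P x + H * P x = 0\<^sub>m n n"
      using H P [of x] by (simp add: add_mult_distrib_mat [of _ n n _ _ n] mult_smult_assoc_mat [of _ n n _ n])
    have "Y = d \<cdot>\<^sub>m Q" if "- d \<cdot>\<^sub>m Q + Y = 0\<^sub>m n n" "Q \<in> carrier_mat n n" "Y \<in> carrier_mat n n"
      for Y Q :: "'a gext mat" and d
      using that by (auto simp: mat_eq_iff)
    from this [OF * P mult_carrier_mat [OF H P]] show ?thesis .
  qed
  have "P x * P y = (if x = y then P y else 0\<^sub>m n n)" if "x \<in> \<Lambda>" "y \<in> \<Lambda>" for x y
  proof -
    have "P x * P y = poly (map_poly of_base (lagrange \<Lambda> x)) (of_base y) \<cdot>\<^sub>m P y"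
      using poly_mat_eigen [OF H P HP [OF that(2)]] by (simp only: P_def)
    also have "poly (map_poly of_base (lagrange \<Lambda> x)) (of_base y) = of_base (if y = x then 1 else 0)"
      by (simp add: poly_lagrange [OF fin that] ob.poly_map_poly)
    finally show ?thesis using P [of y] by (auto simp: of_base_simps intro!: eq_matI)
  qed
  then show ?thesis
    using fin sum_lagrange [OF fin \<open>\<Lambda> \<noteq> {}\<close>] HP unfolding P_def by blast
qed


theorem proposition4p8:
  fixes A :: "'a::real_closed_field gext mat" and n :: nat
  assumes "A \<in> carrier_mat n n" and "A \<noteq> 0\<^sub>m n n"
  shows "(\<exists>p \<sigma> B. SVD n A p \<sigma> B) \<and>
    (A \<in> base_mats n \<longrightarrow> (\<exists>p \<sigma> B. SVD n A p \<sigma> B \<and> (\<forall>i\<in>{1..p}. B i \<in> base_mats n)))"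
proof -
  \<comment> \<open>One construction serves both claims: its matrices are real as soon as \<open>A\<close> is.\<close>
  note A = assms(1) and A0 = assms(2)
  have n: "0 < n" using A A0 by (cases n) auto
  interpret ob: inj_comm_ring_hom "of_base :: 'a \<Rightarrow> 'a gext" by (rule of_base_hom)
  interpret map_poly_comm_ring_hom "of_base :: 'a \<Rightarrow> 'a gext" ..
  let ?a = "mat_adjoint :: 'a gext mat \<Rightarrow> _"
  note assoc = assoc_mult_mat [of _ n n _ n _ n] mult_carrier_mat [of _ n n _ n]
  note smult = mult_smult_assoc_mat [of _ n n _ n] mult_smult_distrib [of _ n n _ n]
  define H where "H = ?a A * A"
  have aA: "?a A \<in> carrier_mat n n" using A by simp
  have H: "H \<in> carrier_mat n n" unfolding H_def by (rule mult_carrier_mat [OF aA A])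
  have herm: "?a H = H" by (simp add: H_def adjoint_mult [OF aA A] adjoint_adjoint)
  obtain \<Lambda> L where fin: "finite \<Lambda>" and sumL: "(\<Sum>x\<in>\<Lambda>. L x) = 1"
    and HL: "\<forall>x\<in>\<Lambda>. H * poly_mat (map_poly of_base (L x)) H = of_base x \<cdot>\<^sub>m poly_mat (map_poly of_base (L x)) H"
    and LL: "\<forall>x\<in>\<Lambda>. \<forall>y\<in>\<Lambda>. poly_mat (map_poly of_base (L x)) H * poly_mat (map_poly of_base (L y)) H =
      (if x = y then poly_mat (map_poly of_base (L y)) H else 0\<^sub>m n n)"
    using hermitian_spectral_projections [OF H herm n] by blast
  define P where "P = (\<lambda>x. poly_mat (map_poly of_base (L x)) H)"
  have P: "P x \<in> carrier_mat n n" for x using H by (simp add: P_def)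
  have HP: "H * P x = of_base x \<cdot>\<^sub>m P x" if "x \<in> \<Lambda>" for x using HL that by (simp add: P_def)
  have PP: "P x * P y = (if x = y then P y else 0\<^sub>m n n)" if "x \<in> \<Lambda>" "y \<in> \<Lambda>" for x y
    using LL that by (simp add: P_def)
  have aP: "?a (P x) = P x" for x unfolding P_def by (rule adjoint_poly_mat [OF H herm])
  have AP: "A * P x \<in> carrier_mat n n" for x by (rule mult_carrier_mat [OF A P])
  have aAP: "?a (A * P x) = P x * ?a A" for x by (simp add: adjoint_mult [OF A P] aP)
  have gram: "?a (A * P x) * (A * P y) = (if x = y then of_base y \<cdot>\<^sub>m P y else 0\<^sub>m n n)"
    if "x \<in> \<Lambda>" "y \<in> \<Lambda>" for x y
  proof -
    have "?a (A * P x) * (A * P y) = P x * (H * P y)"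
      using A aA P by (simp add: aAP H_def assoc)
    also have "\<dots> = of_base y \<cdot>\<^sub>m (P x * P y)" using P by (simp add: HP [OF that(2)] smult)
    finally show ?thesis using PP [OF that] by simp
  qed
  have pos: "0 < x" if x: "x \<in> \<Lambda>" and nz: "A * P x \<noteq> 0\<^sub>m n n" for x
  proof -
    obtain i j where ij: "i < n" "j < n" "(A * P x) $$ (i, j) \<noteq> 0"
      using nz AP [of x] unfolding mat_eq_iff by auto
    have "0 < re_part ((?a (A * P x) * (A * P x)) $$ (j, j))"
      by (rule gram_diag_pos [OF AP ij])
    also have "\<dots> = x * re_part (P x $$ (j, j))"
      using ij P [of x] by (simp only: gram [OF x x] if_True) (simp add: of_base_def times_gext_def)
    finally have "0 < x * re_part (P x $$ (j, j))" .
    moreover have "0 \<le> re_part (P x $$ (j, j))"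
      using gram_diag_nonneg [OF P ij(2), of x] by (simp add: aP PP [OF x x] del: index_mult_mat(1))
    ultimately show ?thesis by (simp add: zero_less_mult_iff)
  qed
  \<comment> \<open>The set of singular values.\<close>
  define S where "S = {s. 0 < s \<and> s * s \<in> \<Lambda> \<and> A * P (s * s) \<noteq> 0\<^sub>m n n}"
  have bij: "bij_betw (\<lambda>s. s * s) S {x \<in> \<Lambda>. A * P x \<noteq> 0\<^sub>m n n}"
  proof (rule bij_betwI')
    fix s t assume "s \<in> S" "t \<in> S"
    then have "0 < s" "0 < t" by (auto simp: S_def)
    then show "(s * s = t * t) = (s = t)" by (auto simp: square_eq_iff)
  next
    fix x assume "x \<in> {x \<in> \<Lambda>. A * P x \<noteq> 0\<^sub>m n n}"
    then have x: "x \<in> \<Lambda>" "A * P x \<noteq> 0\<^sub>m n n" by auto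
    then obtain s where s: "s * s = x" using pos nonneg_is_square [of x] by fastforce
    have "\<bar>s\<bar> \<in> S" using x pos [OF x] s by (auto simp: S_def)
    then show "\<exists>s\<in>S. x = s * s" using s by (intro bexI [of _ "\<bar>s\<bar>"]) auto
  qed (auto simp: S_def)
  have finS: "finite S" using bij_betw_finite [OF bij] fin by simp
  define C where "C = (\<lambda>s. of_base (1 / s) \<cdot>\<^sub>m (A * P (s * s)))"
  have C: "C s \<in> carrier_mat n n" for s using AP [of "s * s"] by (simp add: C_def)
  have aC: "?a (C s) = of_base (1 / s) \<cdot>\<^sub>m ?a (A * P (s * s))" for s
    by (simp add: C_def adjoint_smult_of_base)
  have SL: "s * s \<in> \<Lambda>" "0 < s" "A * P (s * s) \<noteq> 0\<^sub>m n n" if "s \<in> S" for s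
    using that by (auto simp: S_def)
  have sC: "of_base s \<cdot>\<^sub>m C s = A * P (s * s)" if "s \<in> S" for s
  proof -
    have "of_base s * of_base (1 / s) = (1 :: 'a gext)"
      using SL(2) [OF that] by (simp add: of_base_simps(4) [symmetric] of_base_simps(2))
    then show ?thesis
      by (intro eq_matI) (auto simp: C_def mult.assoc [symmetric] simp del: index_mult_mat(1))
  qed
  have Cnz: "C s \<noteq> 0\<^sub>m n n" if "s \<in> S" for s
    using sC [OF that] SL(3) [OF that] by (metis smult_zero_mat)
  have orth1: "?a (C s) * C t = 0\<^sub>m n n" if "s \<in> S" "t \<in> S" "s \<noteq> t" for s t
  proof -
    have "s * s \<noteq> t * t" using that bij by (auto simp: bij_betw_def inj_on_def)
    then have "?a (A * P (s * s)) * (A * P (t * t)) = 0\<^sub>m n n"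
      using gram [OF SL(1) [OF that(1)] SL(1) [OF that(2)]] by simp
    then show ?thesis
      unfolding aC unfolding C_def using adjoint_carrier [OF AP [of "s * s"]] AP [of "t * t"] by (simp add: smult)
  qed
  have orth2: "C s * ?a (C t) = 0\<^sub>m n n" if "s \<in> S" "t \<in> S" "s \<noteq> t" for s t
  proof -
    have "s * s \<noteq> t * t" using that bij by (auto simp: bij_betw_def inj_on_def)
    then have "A * (P (s * s) * P (t * t)) * ?a A = 0\<^sub>m n n"
      using PP [OF SL(1) [OF that(1)] SL(1) [OF that(2)]] A aA
      by (simp add: left_mult_zero_mat [OF aA])
    then have "A * P (s * s) * ?a (A * P (t * t)) = 0\<^sub>m n n"
      using A aA P by (simp add: aAP assoc)
    then show ?thesis
      unfolding aC unfolding C_def using adjoint_carrier [OF AP [of "t * t"]] AP [of "s * s"] by (simp add: smult)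
  qed
  have partial: "C s * ?a (C s) * C s = C s" if s: "s \<in> S" for s
  proof -
    let ?x = "s * s"
    have "?a (C s) * C s = of_base (1 / s) \<cdot>\<^sub>m (of_base (1 / s) \<cdot>\<^sub>m (of_base ?x \<cdot>\<^sub>m P ?x))"
      unfolding aC unfolding C_def
      using adjoint_carrier [OF AP [of ?x]] AP [of ?x] gram [OF SL(1) [OF s] SL(1) [OF s]] by (simp add: smult)
    also have "\<dots> = P ?x"
    proof -
      have "of_base (1 / s) * (of_base (1 / s) * of_base ?x) = (1 :: 'a gext)"
        using SL(2) [OF s] by (simp add: of_base_simps(4) [symmetric] of_base_simps(2))
      then show ?thesis by (intro eq_matI) (auto simp: mult.assoc [symmetric])
    qed
    finally have *: "?a (C s) * C s = P ?x" .
    have "C s * ?a (C s) * C s = C s * P ?x"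
      using assoc_mult_mat [OF C adjoint_carrier [OF C] C] by (simp add: *)
    also have "\<dots> = of_base (1 / s) \<cdot>\<^sub>m (A * (P ?x * P ?x))"
      using A P AP by (simp add: C_def smult assoc)
    also have "\<dots> = C s" using PP [OF SL(1) [OF s] SL(1) [OF s]] by (simp add: C_def)
    finally show ?thesis .
  qed
  have sumC: "(\<Sum>s\<in>S. (of_base s \<cdot>\<^sub>m C s) $$ (i, j)) = A $$ (i, j)" if ij: "i < n" "j < n" for i j
  proof -
    have "(\<Sum>s\<in>S. (of_base s \<cdot>\<^sub>m C s) $$ (i, j)) = (\<Sum>s\<in>S. (A * P (s * s)) $$ (i, j))"
      by (intro sum.cong refl) (simp only: sC)
    also have "\<dots> = (\<Sum>x\<in>{x \<in> \<Lambda>. A * P x \<noteq> 0\<^sub>m n n}. (A * P x) $$ (i, j))"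
      by (rule sum.reindex_bij_betw [OF bij])
    also have "\<dots> = (\<Sum>x\<in>\<Lambda>. (A * P x) $$ (i, j))"
      using fin ij by (intro sum.mono_neutral_left) auto
    also have "\<dots> = (\<Sum>x\<in>\<Lambda>. \<Sum>k<n. A $$ (i, k) * P x $$ (k, j))"
      using ij A by (intro sum.cong refl) (simp add: scalar_prod_def atLeast0LessThan carrier_matD [OF P])
    also have "\<dots> = (\<Sum>k<n. A $$ (i, k) * (\<Sum>x\<in>\<Lambda>. P x $$ (k, j)))"
      by (subst sum.swap) (simp add: sum_distrib_left)
    also have "\<dots> = (\<Sum>k<n. A $$ (i, k) * 1\<^sub>m n $$ (k, j))"
    proof (intro sum.cong refl)
      fix k assume "k \<in> {..<n}"
      then have "(\<Sum>x\<in>\<Lambda>. P x $$ (k, j)) = poly_mat (\<Sum>x\<in>\<Lambda>. map_poly of_base (L x)) H $$ (k, j)"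
        by (simp add: P_def poly_mat_sum_index [OF H _ ij(2)])
      also have "(\<Sum>x\<in>\<Lambda>. map_poly of_base (L x)) = (1 :: 'a gext poly)"
        by (simp add: hom_sum [symmetric] sumL)
      finally show "A $$ (i, k) * (\<Sum>x\<in>\<Lambda>. P x $$ (k, j)) = A $$ (i, k) * 1\<^sub>m n $$ (k, j)"
        using H by simp
    qed
    also have "\<dots> = A $$ (i, j)" using ij by (simp add: if_distrib [of "times _"] cong: if_cong)
    finally show ?thesis .
  qed
  define p where "p = card S"
  define xs where "xs = sorted_list_of_set S"
  \<comment> \<open>\<open>xs\<close> is increasing and indexed from 0, so position \<open>p - i\<close> holds the \<open>i\<close>-th largest singular value.\<close>
  define \<sigma> where "\<sigma> = (\<lambda>i. xs ! (p - i))"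
  define B where "B = (\<lambda>i. C (\<sigma> i))"
  have xs: "set xs = S" "length xs = p" "sorted_wrt (<) xs" "distinct xs"
    using finS by (simp_all add: xs_def p_def)
  have anti: "strict_antimono_on {1..p} \<sigma>"
  proof (rule monotone_onI)
    fix i j assume "i \<in> {1..p}" "j \<in> {1..p}" "i < j"
    then have "p - j < p - i" "p - i < length xs" using xs(2) by auto
    then show "\<sigma> j < \<sigma> i" unfolding \<sigma>_def by (intro sorted_wrt_nth_less [OF xs(3)])
  qed
  have \<sigma>S: "\<sigma> i \<in> S" if "i \<in> {1..p}" for i
    using that xs nth_mem [of "p - i" xs] by (auto simp: \<sigma>_def)
  have inj: "inj_on \<sigma> {1..p}"
  proof (rule inj_onI)
    fix i j assume "i \<in> {1..p}" "j \<in> {1..p}" "\<sigma> i = \<sigma> j"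
    then show "i = j"
      using monotone_onD [OF anti, of i j] monotone_onD [OF anti, of j i] by (cases i j rule: linorder_cases) auto
  qed
  have "\<sigma> ` {1..p} = S"
    using \<sigma>S inj finS by (intro card_subset_eq) (auto simp: card_image p_def)
  with inj have bij\<sigma>: "bij_betw \<sigma> {1..p} S" by (simp add: bij_betw_def)
  have "S \<noteq> {}"
  proof
    assume "S = {}"
    then have "A = 0\<^sub>m n n" using sumC A by (intro eq_matI) auto
    then show False using A0 by simp
  qed
  then have p1: "1 \<le> p" using finS by (simp add: p_def card_gt_0_iff Suc_le_eq)
  have Bc: "of_base (\<sigma> i) \<cdot>\<^sub>m B i \<in> carrier_mat n n" for i using C by (simp add: B_def)
  have sumB: "A = (\<Oplus>\<^bsub>ring_mat TYPE('a gext) n ()\<^esub> i\<in>{1..p}. of_base (\<sigma> i) \<cdot>\<^sub>m B i)" (is "A = ?sum")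
  proof (rule eq_matI)
    note fs = finsum_mat_index [of "{1..p}" "\<lambda>i. of_base (\<sigma> i) \<cdot>\<^sub>m B i" n, OF _ Bc]
    have c: "?sum \<in> carrier_mat n n" using fs(2) [OF _ n n] by simp
    then show "dim_row A = dim_row ?sum" "dim_col A = dim_col ?sum" using A by auto
    fix i j assume "i < dim_row ?sum" "j < dim_col ?sum"
    then have ij: "i < n" "j < n" using c by auto
    have "?sum $$ (i, j) = (\<Sum>k\<in>{1..p}. (of_base (\<sigma> k) \<cdot>\<^sub>m C (\<sigma> k)) $$ (i, j))"
      using fs(1) [OF _ ij] by (simp add: B_def)
    also have "\<dots> = (\<Sum>s\<in>S. (of_base s \<cdot>\<^sub>m C s) $$ (i, j))"
      by (rule sum.reindex_bij_betw [OF bij\<sigma>])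
    finally show "A $$ (i, j) = ?sum $$ (i, j)" using sumC [OF ij] by simp
  qed
  have "SVD_system n p B"
    unfolding SVD_system_def
  proof (intro conjI ballI impI)
    fix i j assume "i \<in> {1..p}" "j \<in> {1..p}" "i \<noteq> j"
    then have *: "\<sigma> i \<in> S" "\<sigma> j \<in> S" "\<sigma> i \<noteq> \<sigma> j" using \<sigma>S [of i] \<sigma>S [of j] inj_onD [OF inj, of i j] by blast+
    show "?a (B i) * B j = 0\<^sub>m n n" "B i * ?a (B j) = 0\<^sub>m n n"
      unfolding B_def by (rule orth1 [OF *]) (rule orth2 [OF *])
  next
    fix i assume "i \<in> {1..p}"
    then have "\<sigma> i \<in> S" by (rule \<sigma>S)
    then show "B i \<in> carrier_mat n n" "B i \<noteq> 0\<^sub>m n n" "B i * ?a (B i) * B i = B i"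
      unfolding B_def using C [of "\<sigma> i"] Cnz [of "\<sigma> i"] partial [of "\<sigma> i"] by blast+
  qed (rule p1)
  then have "SVD n A p \<sigma> B"
    unfolding SVD_def using anti \<sigma>S SL(2) sumB by blast
  moreover have "B i \<in> base_mats n" if "A \<in> base_mats n" for i
    unfolding B_def C_def P_def H_def by (rule base_mats_gram_poly [OF that])
  ultimately show ?thesis by blast
qed

end
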